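(* Suppose $S_0\subset\Delta$ and the invariant functions $\eta,t$ satisfy $\check h^\ell_\eta=\hbar$ for all $\ell=1,\dots,m$ and $t_{\alpha^\vee}^2=e^{\eta_{\alpha^\vee}}$ for all $\alpha\in R$. Then the ideal $I_{\mathcal D}=\{f\in\check{\mathcal F}:f|_{\mathcal D}=0\}$ is invariant under the action of the double affine Hecke algebra $\mathbb H^{\hat R^\vee}_t$, i.e. under the operators $X^\mu$, $\pi_r$ ($r\in\mathcal O$) and $T_0,\dots,T_n$.
   Context: $R$ is an irreducible reduced root system of rank $n$ in $V=\mathbb C^n$, standard bilinear form, $\beta^\vee=2\beta/(\beta,\beta)$, Weyl group $W$, positive roots $R_+$, simple roots $\Delta=\{\alpha_1,\dots,\alpha_n\}$, maximal root $\theta=\sum n_i\alpha_i$, root lattice $Q$, coweight lattice $P^\vee$ with fundamental coweights $b_i$. $\hbar\in\mathbb C\setminus\pi i\mathbb Q$, $\hbar\ne0$. Affine functions $[\alpha^{(1)},\alpha^{(0)}]:x\mapsto(\alpha^{(1)},x)+\alpha^{(0)}$, with $[\alpha^{(1)},\alpha^{(0)}]^\vee=\frac{2}{(\alpha^{(1)},\alpha^{(1)})}[\alpha^{(1)},\alpha^{(0)}]$; $\alpha_0=[-\theta,\hbar]$; $s_i$ the reflection in $\{\alpha_i=0\}$; $\tau(\lambda)x=x+\hbar\lambda$; $\hat W=W\ltimes\tau(P^\vee)$ acting on affine functions by $w\tau(\lambda)[\alpha^{(1)},\alpha^{(0)}]=[w\alpha^{(1)},\alpha^{(0)}-\hbar(\alpha^{(1)},\lambda)]$.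 $\mathcal O=\{0\}\cup\{r:n_r=1\}$, $\pi_0=1$, $\pi_r=\tau(b_r)u_r^{-1}$ ($u_r\in W$ preserving $\{-\theta,\alpha_1,..,\alpha_n\}$, $u_r\alpha_r=-\theta$). $\hat R^\vee=\{[\alpha,\hbar k]^\vee:\alpha\in R,k\in\mathbb Z\}$; $t,\eta:\hat R^\vee\to\mathbb C$ are $\hat W$-invariant with $t$ nonzero, $t_i=t_{\alpha_i^\vee}$ ($i=0,\dots,n$), and $\eta_{\alpha^\vee}$ denotes $\eta([\alpha,0]^\vee)$. $\check{\mathcal F}$ = smooth functions on $V$ with $f(x+2\pi i\alpha_j)=f(x)$ for all $j$. Representation: $X^\mu f=e^{\mu(x)}f$ for $\mu=[\mu^{(1)},\mu^{(0)}]$, $\mu^{(1)}\in P^\vee$, $\mu^{(0)}\in\frac{\hbar}{\epsilon_0}\mathbb Z$ ($(P^\vee,P^\vee)\subset\epsilon_0^{-1}\mathbb Z$); $(\pi_rf)(x)=f(\pi_r^{-1}x)$; $T_i=\frac{t_i-t_i^{-1}}{1-e^{-\alpha_i^\vee(x)}}+\frac{t_i^{-1}-t_ie^{-\alpha_i^\vee(x)}}{1-e^{-\alpha_i^\vee(x)}}s_i$, $(s_if)(x)=f(s_ix)$. Fix $S_0\subset\Delta$, $W_+=\{w\in W:wS_0\subset R_+\}$, $\mathcal D_0=\{x:(\alpha^\vee,x)=\eta_{\alpha^\vee}\ \forall\alpha\in S_0\}$, $\mathcal D=\bigcup_{w\in W_+}w\mathcal D_0$. $R_0=\mathrm{span}(S_0)\cap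 R=\bigsqcup_{\ell=1}^mR_\ell$ irreducible components, $S_\ell=S_0\cap R_\ell=\{\alpha^\ell_1,..,\alpha^\ell_{k_\ell}\}$, $\theta_\ell=\sum_jn^\ell_j\alpha^\ell_j$ the maximal root of $R_\ell$, and $\check h^\ell_\eta=\frac{(\theta_\ell,\theta_\ell)}2\eta_{\theta_\ell^\vee}+\sum_j\frac{(\alpha^\ell_j,\alpha^\ell_j)}2n^\ell_j\eta_{(\alpha^\ell_j)^\vee}$.
   Formalization: "Smooth functions on V" is taken to mean holomorphic functions on C^n: for merely real-smooth functions the operators T_i do not preserve the space (T_i f can be discontinuous where e^{-α_i^∨(x)}=1), so the action would be undefined. *)

theory Defs
  imports "HOL-Analysis.Analysis"
begin

(* V = C^n is  complex^'n ; the standard (complex bilinear, not Hermitian) form *)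
definition bf :: "complex^'n \<Rightarrow> complex^'n \<Rightarrow> complex" where
  "bf x y = (\<Sum>i\<in>UNIV. x$i * y$i)"

definition cor :: "complex^'n \<Rightarrow> complex^'n" where
  "cor a = (2 / bf a a) *s a"

definition refl :: "complex^'n \<Rightarrow> complex^'n \<Rightarrow> complex^'n" where
  "refl a x = x - bf (cor a) x *s a"

definition real_vec :: "complex^'n \<Rightarrow> bool" where
  "real_vec v \<longleftrightarrow> (\<forall>i. v$i \<in> \<real>)"

definition is_root_system :: "(complex^'n) set \<Rightarrow> bool" where
  "is_root_system R \<longleftrightarrow>
     finite R \<and> 0 \<notin> R \<and> (\<forall>a\<in>R. real_vec a) \<and>
     (\<forall>v. real_vec v \<longrightarrow> v \<in> span R) \<and>
     (\<forall>a\<in>R. refl a ` R = R) \<and>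
     (\<forall>a\<in>R. \<forall>b\<in>R. bf b (cor a) \<in> \<int>) \<and>
     (\<forall>a\<in>R. \<forall>c. c *s a \<in> R \<longrightarrow> c = 1 \<or> c = -1)"

definition irreducible_rs :: "(complex^'n) set \<Rightarrow> bool" where
  "irreducible_rs R \<longleftrightarrow> \<not> (\<exists>A B. A \<union> B = R \<and> A \<inter> B = {} \<and> A \<noteq> {} \<and> B \<noteq> {} \<and>
        (\<forall>a\<in>A. \<forall>b\<in>B. bf a b = 0))"

definition nncomb :: "('n \<Rightarrow> complex^'n) \<Rightarrow> 'n set \<Rightarrow> complex^'n \<Rightarrow> bool" where
  "nncomb \<alpha> J v \<longleftrightarrow> (\<exists>c::'n \<Rightarrow> nat. v = (\<Sum>j\<in>J. of_nat (c j) *s \<alpha> j))"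

definition simple_system :: "(complex^'n) set \<Rightarrow> ('n \<Rightarrow> complex^'n) \<Rightarrow> bool" where
  "simple_system R \<alpha> \<longleftrightarrow> (\<forall>i. \<alpha> i \<in> R) \<and>
     (\<forall>b\<in>R. nncomb \<alpha> UNIV b \<or> nncomb \<alpha> UNIV (- b))"

definition pos_roots :: "(complex^'n) set \<Rightarrow> ('n \<Rightarrow> complex^'n) \<Rightarrow> (complex^'n) set" where
  "pos_roots R \<alpha> = {b\<in>R. nncomb \<alpha> UNIV b}"

inductive_set weyl :: "(complex^'n) set \<Rightarrow> (complex^'n \<Rightarrow> complex^'n) set" for R where
  weyl_id: "id \<in> weyl R"
| weyl_step: "a \<in> R \<Longrightarrow> w \<in> weyl R \<Longrightarrow> refl a \<circ> w \<in> weyl R"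

definition coweights :: "(complex^'n) set \<Rightarrow> (complex^'n) set" where
  "coweights R = {l. \<forall>a\<in>R. bf a l \<in> \<int>}"

definition aev :: "(complex^'n) \<times> complex \<Rightarrow> complex^'n \<Rightarrow> complex" where
  "aev a x = bf (fst a) x + snd a"

definition aff_cor :: "(complex^'n) \<times> complex \<Rightarrow> (complex^'n) \<times> complex" where
  "aff_cor a = ((2 / bf (fst a) (fst a)) *s fst a, (2 / bf (fst a) (fst a)) * snd a)"

definition aff_coroots :: "(complex^'n) set \<Rightarrow> complex \<Rightarrow> ((complex^'n) \<times> complex) set" where
  "aff_coroots R h = {aff_cor (a, h * of_int k) | a k. a \<in> R}"

(* action of w tau(lambda) on affine functions *)
definition waff :: "complex \<Rightarrow> (complex^'n \<Rightarrow> complex^'n) \<Rightarrow> complex^'n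
                     \<Rightarrow> (complex^'n) \<times> complex \<Rightarrow> (complex^'n) \<times> complex" where
  "waff h w l a = (w (fst a), snd a - h * bf (fst a) l)"

definition hatW_invariant :: "(complex^'n) set \<Rightarrow> complex \<Rightarrow> ((complex^'n) \<times> complex \<Rightarrow> complex) \<Rightarrow> bool" where
  "hatW_invariant R h t \<longleftrightarrow>
     (\<forall>w\<in>weyl R. \<forall>l\<in>coweights R. \<forall>a\<in>aff_coroots R h. t (waff h w l a) = t a)"

(* affine simple roots: node None = 0 (alpha_0 = [-theta, hbar]), node Some i = alpha_i *)
definition anode :: "('n \<Rightarrow> complex^'n) \<Rightarrow> complex^'n \<Rightarrow> complex \<Rightarrow> 'n option \<Rightarrow> (complex^'n) \<times> complex" where
  "anode \<alpha> \<theta> h i = (case i of None \<Rightarrow> (- \<theta>, h) | Some j \<Rightarrow> (\<alpha> j, 0))"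

definition arefl :: "(complex^'n) \<times> complex \<Rightarrow> complex^'n \<Rightarrow> complex^'n" where
  "arefl a x = x - aev (aff_cor a) x *s fst a"

(* value of T_i f at x, where 1 - e^{-alpha_i^vee(x)} \<noteq> 0 *)
definition Tval :: "complex \<Rightarrow> (complex^'n) \<times> complex \<Rightarrow> (complex^'n \<Rightarrow> complex) \<Rightarrow> complex^'n \<Rightarrow> complex" where
  "Tval ti a f x =
     (let e = exp (- aev (aff_cor a) x) in
       (ti - inverse ti) / (1 - e) * f x + (inverse ti - ti * e) / (1 - e) * f (arefl a x))"

definition holo :: "(complex^'n \<Rightarrow> complex) \<Rightarrow> bool" where
  "holo f \<longleftrightarrow> (\<forall>x. \<exists>L. (f has_derivative L) (at x) \<and> (\<forall>c v. L (c *s v) = c * L v))"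

definition Fcheck :: "('n \<Rightarrow> complex^'n) \<Rightarrow> (complex^'n \<Rightarrow> complex) set" where
  "Fcheck \<alpha> = {f. holo f \<and> (\<forall>x j. f (x + (2 * pi * \<i>) *s \<alpha> j) = f x)}"

definition Wplus :: "(complex^'n) set \<Rightarrow> ('n \<Rightarrow> complex^'n) \<Rightarrow> 'n set \<Rightarrow> (complex^'n \<Rightarrow> complex^'n) set" where
  "Wplus R \<alpha> J = {w \<in> weyl R. \<forall>j\<in>J. w (\<alpha> j) \<in> pos_roots R \<alpha>}"

definition D0 :: "('n \<Rightarrow> complex^'n) \<Rightarrow> 'n set \<Rightarrow> ((complex^'n) \<times> complex \<Rightarrow> complex) \<Rightarrow> (complex^'n) set" where
  "D0 \<alpha> J \<eta> = {x. \<forall>j\<in>J. bf (cor (\<alpha> j)) x = \<eta> (aff_cor (\<alpha> j, 0))}"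

definition Dset :: "(complex^'n) set \<Rightarrow> ('n \<Rightarrow> complex^'n) \<Rightarrow> 'n set \<Rightarrow> ((complex^'n) \<times> complex \<Rightarrow> complex) \<Rightarrow> (complex^'n) set" where
  "Dset R \<alpha> J \<eta> = (\<Union>w\<in>Wplus R \<alpha> J. w ` D0 \<alpha> J \<eta>)"

definition ideal_D :: "(complex^'n) set \<Rightarrow> ('n \<Rightarrow> complex^'n) \<Rightarrow> 'n set \<Rightarrow> ((complex^'n) \<times> complex \<Rightarrow> complex) \<Rightarrow> (complex^'n \<Rightarrow> complex) set" where
  "ideal_D R \<alpha> J \<eta> = {f \<in> Fcheck \<alpha>. \<forall>x\<in>Dset R \<alpha> J \<eta>. f x = 0}"

definition R0 :: "(complex^'n) set \<Rightarrow> ('n \<Rightarrow> complex^'n) \<Rightarrow> 'n set \<Rightarrow> (complex^'n) set" where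
  "R0 R \<alpha> J = span (\<alpha> ` J) \<inter> R"

definition is_component :: "(complex^'n) set \<Rightarrow> (complex^'n) set \<Rightarrow> bool" where
  "is_component S C \<longleftrightarrow> (\<exists>b\<in>S. C = {c\<in>S. (b, c) \<in> {(x, y). x \<in> S \<and> y \<in> S \<and> bf x y \<noteq> 0}\<^sup>*})"

(* check h^l_eta for component C with maximal root thC = sum_j m_j alpha_j (j in JC) *)
definition hcheck :: "('n \<Rightarrow> complex^'n) \<Rightarrow> 'n set \<Rightarrow> ((complex^'n) \<times> complex \<Rightarrow> complex)
                       \<Rightarrow> complex^'n \<Rightarrow> ('n \<Rightarrow> nat) \<Rightarrow> complex" where
  "hcheck \<alpha> JC \<eta> thC m = bf thC thC / 2 * \<eta> (aff_cor (thC, 0))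
      + (\<Sum>j\<in>JC. bf (\<alpha> j) (\<alpha> j) / 2 * of_nat (m j) * \<eta> (aff_cor (\<alpha> j, 0)))"

end

theory Submission
  imports Defs "HOL-Complex_Analysis.Complex_Analysis"
begin

text \<open>
  Let \<open>x = w y\<close> with \<open>w\<close> in \<open>Wplus\<close> and \<open>y\<close> in \<open>D0\<close>. For each component of \<open>R0\<close>, the coroots of the simple
  roots and, by the condition on \<open>h\<close>, also that of the affine simple root, which is \<open>h\<close> minus the highest
  root, take the values of \<open>\<eta>\<close> at \<open>y\<close>; the images of these roots under \<open>w\<close> are positive affine roots. An
  element of the extended affine Weyl group that keeps the images positive maps \<open>x\<close> back into \<open>Dset\<close>: in
  each component exactly one of them ends up with constant term \<open>h\<close>, and the linear parts of the others form
  a simple system, which is conjugate to the original one. The element \<open>\<pi>\<^sub>r\<close> preserves positivity. The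
  reflection \<open>s\<^sub>i\<close> preserves it unless \<open>\<alpha>\<^sub>i\<close> is one of the images; but then \<open>t\<^sub>i\<^sup>2\<close> is the exponential of the
  coroot of \<open>\<alpha>\<^sub>i\<close> at \<open>x\<close>, so the coefficient of \<open>s\<^sub>i\<close> in \<open>T\<^sub>i\<close> vanishes there.
\<close>

section \<open>Holomorphic functions of several variables\<close>

text \<open>Each T_i divides by 1 - exp(- a), where a is the affine coroot of its node, and the
  zeros of this denominator may meet \<open>Dset\<close>. So T_i f is taken to be a function g in
  \<open>Fcheck\<close> that agrees with \<open>Tval\<close> off the zeros. Its existence is a
  removable singularity problem in several variables, and its vanishing at a zero that lies in
  \<open>Dset\<close> is a limit along a complex line: along the root itself if the root is one of
  the images, otherwise along a line that stays inside the same piece of \<open>Dset\<close>.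

  On the combinatorial side, every s_i and the inverse of every pi_r has the form x -> s (x - h l)
  with s in the Weyl group, so a single lemma can serve all of them. Such a map turns a finite root
  p into the affine root with linear part s p and constant term h (p, l). The pairing (p, l) is the
  level; at the roots that matter it is 0 with s p positive, or 1 with s p negative.\<close>

definition holo_on :: "(complex^'n) set \<Rightarrow> (complex^'n \<Rightarrow> complex) \<Rightarrow> bool" where
  "holo_on U f \<longleftrightarrow> (\<forall>x\<in>U. \<exists>L. (f has_derivative L) (at x) \<and> (\<forall>c v. L (c *s v) = c * L v))"

lemma holo_iff: "holo f \<longleftrightarrow> holo_on UNIV f"
  by (simp add: holo_def holo_on_def)

text \<open>Bundled as a bounded linear map because differentiation under the integral sign, needed
  in \<open>holo_division\<close>, asks for a derivative that is continuous with values in this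
  type.\<close>

definition fd :: "(complex^'n \<Rightarrow> complex) \<Rightarrow> complex^'n \<Rightarrow> (complex^'n) \<Rightarrow>\<^sub>L complex" where
  "fd f x = Blinfun (frechet_derivative f (at x))"

lemma fd_has_derivative:
  assumes "holo_on U f" "x \<in> U"
  shows "(f has_derivative blinfun_apply (fd f x)) (at x)"
    and "fd f x (c *s v) = c * fd f x v"
proof -
  obtain L where L: "(f has_derivative L) (at x)" "\<And>c v. L (c *s v) = c * L v"
    using assms by (auto simp: holo_on_def)
  then have "frechet_derivative f (at x) = L" by (metis frechet_derivative_at)
  moreover have "bounded_linear L" using L(1) by (rule has_derivative_bounded_linear)
  ultimately have "blinfun_apply (fd f x) = L" by (simp add: fd_def bounded_linear_Blinfun_apply)
  with L show "(f has_derivative blinfun_apply (fd f x)) (at x)" "fd f x (c *s v) = c * fd f x v"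
    by auto
qed

lemma bounded_linear_vector_scalar_mult_left: "bounded_linear (\<lambda>c::complex. c *s (v::complex^'n))"
proof (rule linear_conv_bounded_linear[THEN iffD1], rule linearI)
  show "(b1 + b2) *s v = b1 *s v + b2 *s v" for b1 b2 by (simp add: vector_sadd_rdistrib)
  show "(r *\<^sub>R b) *s v = r *\<^sub>R (b *s v)" for r b by (simp add: vec_eq_iff)
qed

lemma bounded_linear_bf: "bounded_linear (bf (c::complex^'n))"
proof (rule linear_conv_bounded_linear[THEN iffD1], rule linearI)
  show "bf c (b1 + b2) = bf c b1 + bf c b2" for b1 b2
    by (simp add: bf_def ring_distribs sum.distrib)
  show "bf c (r *\<^sub>R b) = r *\<^sub>R bf c b" for r and b :: "complex^'n"
    by (simp add: bf_def scaleR_sum_right)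
qed

lemma holo_on_line:
  assumes "holo_on U f" "x + \<zeta> *s v \<in> U"
  shows "((\<lambda>\<zeta>. f (x + \<zeta> *s v)) has_field_derivative fd f (x + \<zeta> *s v) v) (at \<zeta>)"
proof -
  have 1: "((\<lambda>\<zeta>. x + \<zeta> *s v) has_derivative (\<lambda>\<zeta>. \<zeta> *s v)) (at \<zeta>)"
    using has_derivative_add[OF has_derivative_const[of x]
        bounded_linear_imp_has_derivative[OF bounded_linear_vector_scalar_mult_left]] by simp
  have "((\<lambda>\<zeta>. f (x + \<zeta> *s v)) has_derivative (\<lambda>\<zeta>'. fd f (x + \<zeta> *s v) (\<zeta>' *s v))) (at \<zeta>)"
    using has_derivative_compose[OF 1 fd_has_derivative(1)[OF assms]] by simp
  then show ?thesis
    by (simp add: fd_has_derivative(2)[OF assms] has_field_derivative_def mult_commute_abs)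
qed

lemma holo_on_continuous_on: "holo_on U f \<Longrightarrow> continuous_on U f"
  by (meson continuous_at_imp_continuous_on fd_has_derivative(1) has_derivative_continuous)

text \<open>Cauchy's formulas at the centre of a disc, pulled back to the unit interval: the
  derivative of the circle is 2 pi i times the point on it, which cancels one factor of the
  denominator. In this form the dependence on a parameter is governed by theorems on real
  integrals.\<close>

lemma circle_integral:
  assumes "continuous_on (cball 0 r) f" "f holomorphic_on ball 0 r" "0 < r"
  shows "f 0 = integral (cbox 0 1) (\<lambda>t. f (of_real r * exp (2 * of_real pi * \<i> * of_real t)))"
    and "deriv f 0 = integral (cbox 0 1) (\<lambda>t. f (of_real r * exp (2 * of_real pi * \<i> * of_real t))
                        / (of_real r * exp (2 * of_real pi * \<i> * of_real t)))"
proof -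
  define c where "c = (\<lambda>t. complex_of_real r * exp (2 * of_real pi * \<i> * of_real t))"
  define K where "K = 2 * complex_of_real pi * \<i>"
  have K: "K \<noteq> 0" by (simp add: K_def)
  have nz: "c t \<noteq> 0" for t using assms by (simp add: c_def)
  have vd: "vector_derivative (circlepath 0 r) (at t within {0..1}) = K * c t" if "t \<in> {0..1}" for t
    using that vector_derivative_circlepath01[of t 0 r] by (auto simp: c_def K_def algebra_simps)
  have cp: "circlepath 0 r t = c t" for t by (simp add: circlepath c_def)
  have mult: "(g has_integral I) {0..1}" if "((\<lambda>t. K * g t) has_integral (K * I)) {0..1}" for g I
    using has_integral_mult_right[OF that, of "inverse K"] K by (simp add: mult.assoc[symmetric])
  have "((\<lambda>u. f u/(u-0)) has_contour_integral (K * f 0)) (circlepath 0 r)"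
    unfolding K_def by (rule Cauchy_integral_circlepath) (use assms in auto)
  then have "((\<lambda>t. f (c t)/(c t) * vector_derivative (circlepath 0 r) (at t within {0..1})) has_integral (K * f 0)) {0..1}"
    by (simp add: has_contour_integral_def cp)
  then have "((\<lambda>t. K * f (c t)) has_integral (K * f 0)) {0..1}"
    by (rule has_integral_eq[rotated]) (simp add: vd nz)
  from mult[OF this] show "f 0 = integral (cbox 0 1) (\<lambda>t. f (of_real r * exp (2 * of_real pi * \<i> * of_real t)))"
    by (simp add: integral_unique c_def)
  have "((\<lambda>u. f u/(u-0)^Suc 1) has_contour_integral (2 * pi * \<i> / fact 1 * (deriv ^^ 1) f 0)) (circlepath 0 r)"
    by (rule Cauchy_has_contour_integral_higher_derivative_circlepath) (use assms in auto)
  then have "((\<lambda>t. f (c t)/(c t)^2 * vector_derivative (circlepath 0 r) (at t within {0..1})) has_integral (K * deriv f 0)) {0..1}"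
    by (simp add: has_contour_integral_def cp power2_eq_square K_def)
  then have "((\<lambda>t. K * (f (c t)/c t)) has_integral (K * deriv f 0)) {0..1}"
    by (rule has_integral_eq[rotated]) (simp add: vd nz power2_eq_square)
  from mult[OF this] show "deriv f 0 = integral (cbox 0 1) (\<lambda>t. f (of_real r * exp (2 * of_real pi * \<i> * of_real t))
                        / (of_real r * exp (2 * of_real pi * \<i> * of_real t)))"
    by (simp add: integral_unique c_def)
qed

lemma continuous_on_vector_scalar_mult [continuous_intros]:
  fixes f :: "'a::topological_space \<Rightarrow> complex" and g :: "'a \<Rightarrow> complex^'n"
  assumes "continuous_on S f" "continuous_on S g"
  shows "continuous_on S (\<lambda>x. f x *s g x)"
  unfolding vector_scalar_mult_def by (intro continuous_intros assms)

lemma norm_vector_scalar_mult: "norm (c *s (v::complex^'n)) = norm c * norm v"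
proof -
  have "norm (c *s v) = L2_set (\<lambda>i. norm c * norm (v $ i)) UNIV" by (simp add: norm_vec_def norm_mult)
  then show ?thesis by (simp add: L2_set_right_distrib norm_vec_def)
qed

text \<open>Cauchy's formula on circles in the direction of \<open>v\<close> expresses the derivative through the values
  of \<open>f\<close>, so that its continuity need not be assumed.\<close>
lemma continuous_on_fd:
  fixes f :: "complex^'n \<Rightarrow> complex"
  assumes f: "holo_on U f" and U: "open U"
  shows "continuous_on U (fd f)"
proof (rule continuous_on_blinfun_componentwise)
  fix v :: "complex^'n" assume v: "v \<in> Basis"
  then have nv: "norm v = 1" by simp
  show "continuous_on U (\<lambda>x. fd f x v)"
  proof (rule continuous_at_imp_continuous_on, rule ballI)
    fix x assume "x \<in> U"
    then obtain e where e: "e > 0" "ball x e \<subseteq> U" using openE[OF U] by metis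
    \<comment> \<open>A third of the radius: centres within r of x and displacements shorter than 2r
      stay in the ball. Allowing 2r instead of r provides an open disc around the closed disc of
      integration.\<close>
    define r where "r = e/3"
    have r: "r > 0" using e by (simp add: r_def)
    have in_U: "y + \<zeta> *s v \<in> U" if "y \<in> ball x r" "norm \<zeta> < 2*r" for y \<zeta>
    proof -
      have "dist x (y + \<zeta> *s v) \<le> dist x y + norm (\<zeta> *s v)" by (metis add.commute add_diff_cancel_left' dist_norm dist_triangle norm_minus_commute)
      also have "\<dots> < r + 2*r" using that nv by (simp add: norm_vector_scalar_mult)
      finally show ?thesis using e by (auto simp: r_def)
    qed
    let ?c = "\<lambda>t. complex_of_real r * exp (2 * of_real pi * \<i> * of_real t)"
    have nc: "norm (?c t) = r" for t using r by (simp add: norm_mult)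
    have eq: "fd f y v = integral (cbox 0 1) (\<lambda>t. f (y + ?c t *s v) / ?c t)" if y: "y \<in> ball x r" for y
    proof -
      have d: "((\<lambda>\<zeta>. f (y + \<zeta> *s v)) has_field_derivative fd f (y + \<zeta> *s v) v) (at \<zeta>)" if "norm \<zeta> < 2*r" for \<zeta>
        by (rule holo_on_line[OF f in_U[OF y that]])
      have h: "(\<lambda>\<zeta>. f (y + \<zeta> *s v)) holomorphic_on ball 0 (2*r)"
        unfolding holomorphic_on_open[OF open_ball]
      proof
        fix \<zeta> :: complex assume "\<zeta> \<in> ball 0 (2*r)"
        then have "norm \<zeta> < 2*r" by simp
        from d[OF this] show "\<exists>f'. ((\<lambda>\<zeta>. f (y + \<zeta> *s v)) has_field_derivative f') (at \<zeta>)" by blast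
      qed
      have sub: "cball 0 r \<subseteq> ball 0 (2*r)" using r by (auto simp: dist_norm)
      have "deriv (\<lambda>\<zeta>. f (y + \<zeta> *s v)) 0 = integral (cbox 0 1) (\<lambda>t. f (y + ?c t *s v) / ?c t)"
      proof (rule circle_integral(2))
        have "(\<lambda>\<zeta>. f (y + \<zeta> *s v)) holomorphic_on cball 0 r" by (rule holomorphic_on_subset[OF h sub])
        then show "continuous_on (cball 0 r) (\<lambda>\<zeta>. f (y + \<zeta> *s v))" "(\<lambda>\<zeta>. f (y + \<zeta> *s v)) holomorphic_on ball 0 r"
          by (simp_all add: holomorphic_on_imp_continuous_on holomorphic_on_subset[OF _ ball_subset_cball])
      qed (rule r)
      moreover have "deriv (\<lambda>\<zeta>. f (y + \<zeta> *s v)) 0 = fd f y v"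
        using d[of 0] r by (simp add: DERIV_imp_deriv)
      ultimately show ?thesis by simp
    qed
    have "continuous_on (ball x r) (\<lambda>y. integral (cbox 0 1) (\<lambda>t. f (y + ?c t *s v) / ?c t))"
    proof (rule integral_continuous_on_param)
      have "continuous_on (ball x r \<times> cbox 0 1) (\<lambda>z. f (fst z + ?c (snd z) *s v) / ?c (snd z))"
      proof (intro continuous_on_divide continuous_on_compose2[OF holo_on_continuous_on[OF f]])
        show "(\<lambda>z. fst z + ?c (snd z) *s v) ` (ball x r \<times> cbox 0 1) \<subseteq> U"
        proof
          fix u assume "u \<in> (\<lambda>z. fst z + ?c (snd z) *s v) ` (ball x r \<times> cbox 0 1)"
          then obtain y t where "y \<in> ball x r" "u = y + ?c t *s v"
            by (elim imageE SigmaE) (simp only: fst_conv snd_conv)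
          then show "u \<in> U" using in_U[of y "?c t"] nc[of t] r by simp
        qed
      qed (use r in \<open>auto intro!: continuous_intros\<close>)
      then show "continuous_on (ball x r \<times> cbox 0 1) (\<lambda>(y, t). f (y + ?c t *s v) / ?c t)"
        by (simp add: case_prod_unfold)
    qed
    then have "continuous_on (ball x r) (\<lambda>y. fd f y v)" by (rule continuous_on_eq) (use eq in auto)
    then show "isCont (\<lambda>y. fd f y v) x" using r by (simp add: continuous_on_eq_continuous_at)
  qed
qed

section \<open>Closure properties of holomorphic functions\<close>

lemma holo_onI:
  assumes "\<And>x. x \<in> U \<Longrightarrow> (f has_derivative L x) (at x)"
    and "\<And>x c v. x \<in> U \<Longrightarrow> L x (c *s v) = c * L x v"
  shows "holo_on U f"
  using assms unfolding holo_on_def by blast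

lemma holo_on_mult:
  assumes "holo_on U f" "holo_on U g" shows "holo_on U (\<lambda>x. f x * g x)"
proof (rule holo_onI)
  fix x assume x: "x \<in> U"
  show "((\<lambda>x. f x * g x) has_derivative (\<lambda>v. f x * fd g x v + fd f x v * g x)) (at x)"
    by (rule has_derivative_mult) (use fd_has_derivative(1) assms x in auto)
  show "f x * fd g x (c *s v) + fd f x (c *s v) * g x = c * (f x * fd g x v + fd f x v * g x)" for c v
    by (simp add: fd_has_derivative(2)[OF assms(1) x] fd_has_derivative(2)[OF assms(2) x] algebra_simps)
qed

lemma holo_on_add:
  assumes "holo_on U f" "holo_on U g" shows "holo_on U (\<lambda>x. f x + g x)"
proof (rule holo_onI)
  fix x assume x: "x \<in> U"
  show "((\<lambda>x. f x + g x) has_derivative (\<lambda>v. fd f x v + fd g x v)) (at x)"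
    by (rule has_derivative_add) (use fd_has_derivative(1) assms x in auto)
  show "fd f x (c *s v) + fd g x (c *s v) = c * (fd f x v + fd g x v)" for c v
    by (simp add: fd_has_derivative(2)[OF assms(1) x] fd_has_derivative(2)[OF assms(2) x] algebra_simps)
qed

lemma holo_on_field_compose:
  assumes f: "holo_on U f" and g: "\<And>x. x \<in> U \<Longrightarrow> (g has_field_derivative g' (f x)) (at (f x))"
  shows "holo_on U (\<lambda>x. g (f x))"
proof (rule holo_onI)
  fix x assume x: "x \<in> U"
  show "((\<lambda>x. g (f x)) has_derivative (\<lambda>v. g' (f x) * fd f x v)) (at x)"
    using has_derivative_compose[OF fd_has_derivative(1)[OF f x] g[OF x, unfolded has_field_derivative_def]]
    by simp
  show "g' (f x) * fd f x (c *s v) = c * (g' (f x) * fd f x v)" for c v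
    by (simp add: fd_has_derivative(2)[OF f x] algebra_simps)
qed

lemma holo_on_const: "holo_on U (\<lambda>x. c)"
  by (rule holo_onI[where L = "\<lambda>_ _. 0"]) auto

lemma holo_on_bf: "holo_on U (bf c)"
  by (rule holo_onI[where L = "\<lambda>_. bf c"])
     (auto intro!: bounded_linear_imp_has_derivative bounded_linear_bf
      simp: bf_def sum_distrib_left algebra_simps)

lemma holo_on_exp: "holo_on U f \<Longrightarrow> holo_on U (\<lambda>x. exp (f x))"
  by (rule holo_on_field_compose[where g' = exp]) (auto intro: DERIV_exp)

lemma holo_on_cmult: "holo_on U f \<Longrightarrow> holo_on U (\<lambda>x. c * f x)"
  by (intro holo_on_mult holo_on_const)

lemma holo_on_diff: "holo_on U f \<Longrightarrow> holo_on U g \<Longrightarrow> holo_on U (\<lambda>x. f x - g x)"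
  using holo_on_add[of U f "\<lambda>x. (-1) * g x"] holo_on_cmult[of U g "-1"] by simp

lemma holo_on_inverse: "holo_on U f \<Longrightarrow> (\<And>x. x \<in> U \<Longrightarrow> f x \<noteq> 0) \<Longrightarrow> holo_on U (\<lambda>x. inverse (f x))"
  by (erule holo_on_field_compose[where g = inverse and g' = "\<lambda>z. - (inverse z ^ Suc (Suc 0))"])
     (use DERIV_inverse in fastforce)

lemma holo_on_divide:
  "holo_on U f \<Longrightarrow> holo_on U g \<Longrightarrow> (\<And>x. x \<in> U \<Longrightarrow> g x \<noteq> 0) \<Longrightarrow> holo_on U (\<lambda>x. f x / g x)"
  unfolding divide_inverse by (intro holo_on_mult holo_on_inverse)

lemma scaleR_eq_vector_scalar_mult: "r *\<^sub>R (x::complex^'n) = of_real r *s x"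
  by (simp add: vec_eq_iff) (simp add: scaleR_conv_of_real)

lemma holo_compose_affine:
  assumes f: "holo f" and L: "\<And>x y. L (x + y) = L x + L y" "\<And>c x. L (c *s x) = c *s L x"
  shows "holo (\<lambda>x. f (L x + p))"
  unfolding holo_iff
proof (rule holo_onI)
  fix x
  have "linear L" by (rule linearI) (auto simp: L scaleR_eq_vector_scalar_mult)
  then have "bounded_linear L" by (simp add: linear_conv_bounded_linear)
  then have "((\<lambda>x. L x + p) has_derivative (\<lambda>v. L v + 0)) (at x)"
    by (intro has_derivative_add has_derivative_const bounded_linear_imp_has_derivative)
  from has_derivative_compose[OF this fd_has_derivative(1)[of UNIV f]]
  show "((\<lambda>x. f (L x + p)) has_derivative (\<lambda>v. fd f (L x + p) (L v))) (at x)"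
    using f by (simp add: holo_iff)
  show "fd f (L x + p) (L (c *s v)) = c * fd f (L x + p) (L v)" for c v
    using f fd_has_derivative(2)[of UNIV f] by (simp add: L holo_iff)
qed

section \<open>Division by one minus an exponential\<close>

lemma exp_minus_eq_1_iff: "exp (- z) = 1 \<longleftrightarrow> (\<exists>k::int. z = 2 * of_real pi * \<i> * of_int k)"
proof
  assume "exp (- z) = 1"
  then obtain n :: int where "Re z = 0" "- Im z = of_int (2 * n) * pi"
    by (auto simp: exp_eq_1)
  then have "Im z = - (2 * pi * of_int n)" by (simp add: algebra_simps)
  with \<open>Re z = 0\<close> have "z = 2 * of_real pi * \<i> * of_int (- n)" by (simp add: complex_eq_iff)
  then show "\<exists>k::int. z = 2 * of_real pi * \<i> * of_int k" by blast
next
  assume "\<exists>k::int. z = 2 * of_real pi * \<i> * of_int k"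
  then obtain k :: int where "z = 2 * of_real pi * \<i> * of_int k" by blast
  then show "exp (- z) = 1" by (auto simp: exp_eq_1 intro!: exI[of _ "- k"])
qed

text \<open>Different zeros are at least 2 pi apart, so an open disc of that radius about one zero
  contains no other.\<close>

lemma exp_minus_neq_1:
  assumes "z \<noteq> 2 * of_real pi * \<i> * of_int k" "norm (z - 2 * of_real pi * \<i> * of_int k) < 2 * pi"
  shows "exp (- z) \<noteq> 1"
proof
  assume "exp (- z) = 1"
  then obtain m :: int where m: "z = 2 * of_real pi * \<i> * of_int m" by (auto simp: exp_minus_eq_1_iff)
  then have "z - 2 * of_real pi * \<i> * of_int k = of_real (2 * pi * (of_int m - of_int k)) * \<i>"
    by (simp add: algebra_simps)
  then have "norm (z - 2 * of_real pi * \<i> * of_int k) = 2 * pi * \<bar>of_int m - of_int k\<bar>"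
    by (simp only: norm_mult norm_of_real norm_ii) (simp add: abs_mult)
  with assms(2) have "\<bar>of_int m - of_int k :: real\<bar> < 1" by simp
  then have "m = k" by linarith
  with m assms(1) show False by simp
qed

lemma holo_on_transform:
  assumes f: "holo_on U f" and "open U" and eq: "\<And>x. x \<in> U \<Longrightarrow> g x = f x"
  shows "holo_on U g"
proof (rule holo_onI[where L = "\<lambda>x. fd f x"])
  fix x assume x: "x \<in> U"
  show "(g has_derivative fd f x) (at x)"
    by (rule has_derivative_transform_within_open[OF fd_has_derivative(1)[OF f x] \<open>open U\<close> x])
       (simp add: eq)
  show "fd f x (c *s v) = c * fd f x v" for c v by (rule fd_has_derivative(2)[OF f x])
qed

text \<open>The quotient extends over the zeros of the denominator as its own mean over circles in the
  direction of \<open>v\<close> that avoid these zeros.\<close>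
lemma holo_division:
  fixes N :: "complex^'n \<Rightarrow> complex"
  assumes N: "holo N" and v: "bf c v = 1"
    and zero: "\<And>x. exp (- (bf c x + c0)) = 1 \<Longrightarrow> N x = 0"
  shows "\<exists>q. holo q \<and> (\<forall>x. exp (- (bf c x + c0)) \<noteq> 1 \<longrightarrow> q x = N x / (1 - exp (- (bf c x + c0))))"
proof -
  define l where "l = (\<lambda>x. bf c x + c0)"
  define U where "U = {x. exp (- l x) \<noteq> 1}"
  define G where "G = (\<lambda>x. N x / (1 - exp (- l x)))"
  define p :: "int \<Rightarrow> complex" where "p = (\<lambda>k. 2 * of_real pi * \<i> * of_int k)"
  \<comment> \<open>The radii 1 (here) and 2 (in \<open>e\<close>) fit together: for x in
    \<open>W k\<close>, the value of \<open>l\<close> on the circle stays at distance between 1 and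
    3 from \<open>p k\<close>. It therefore avoids this zero, and the others because 3 < 2 pi.
    Convexity of \<open>W k\<close>, shown below, is required for differentiating under the
    integral.\<close>
  define W where "W = (\<lambda>k. {x. norm (l x - p k) < 1})"
  define e where "e = (\<lambda>t. of_real 2 * exp (2 * of_real pi * \<i> * of_real t) :: complex)"
  define M where "M = (\<lambda>x. integral (cbox 0 1) (\<lambda>t. G (x + e t *s v)))"
  have l_line: "l (x + \<zeta> *s v) = l x + \<zeta>" for x \<zeta>
  proof -
    have "bf c (\<zeta> *s v) = \<zeta> * bf c v" by (simp add: bf_def sum_distrib_left algebra_simps)
    moreover have "bf c (x + \<zeta> *s v) = bf c x + bf c (\<zeta> *s v)" by (simp add: bf_def ring_distribs sum.distrib)
    ultimately show ?thesis by (simp add: l_def v)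
  qed
  have l_holo: "holo_on S l" for S unfolding l_def by (intro holo_on_add holo_on_bf holo_on_const)
  have l_cont: "continuous_on S l" for S using l_holo by (rule holo_on_continuous_on)
  have U: "open U" unfolding U_def by (intro open_Collect_neq continuous_intros l_cont)
  have W: "open (W k)" for k unfolding W_def by (intro open_Collect_less continuous_intros l_cont)
  have convW: "convex (W k)" for k
  proof -
    have "linear (bf c)" by (rule bounded_linear.linear[OF bounded_linear_bf])
    then have "convex (bf c -` ball (p k - c0) 1)" by (intro convex_linear_vimage convex_ball)
    moreover have "bf c -` ball (p k - c0) 1 = W k"
      by (auto simp: W_def l_def dist_norm norm_minus_commute algebra_simps)
    ultimately show ?thesis by simp
  qed
  have G: "holo_on U G" unfolding G_def
  proof (rule holo_on_divide)
    show "holo_on U N" using N by (auto simp: holo_on_def holo_def)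
    have "holo_on U (\<lambda>x. exp (0 - l x))" by (intro holo_on_exp holo_on_diff holo_on_const l_holo)
    then show "holo_on U (\<lambda>x. 1 - exp (- l x))" by (intro holo_on_diff holo_on_const) simp
  qed (simp add: U_def)
  have pi3: "pi > 3" using pi_gt3 by simp
  have in_U: "x + \<zeta> *s v \<in> U" if "x \<in> W k" "norm \<zeta> < 3" "l x + \<zeta> \<noteq> p k" for x \<zeta> k
  proof -
    have "norm (l x + \<zeta> - p k) \<le> norm (l x - p k) + norm \<zeta>"
      by (metis add_diff_eq diff_add_eq norm_triangle_ineq)
    also have "\<dots> < 2 * pi" using that pi3 by (simp add: W_def)
    finally show ?thesis
      using exp_minus_neq_1[of "l x + \<zeta>" k] that(3) by (simp add: U_def l_line p_def)
  qed
  have ne: "norm (e t) = 2" for t by (simp add: e_def norm_mult)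
  have circle_in_U: "x + e t *s v \<in> U" if "x \<in> W k" for x t k
  proof (rule in_U[OF that])
    show "l x + e t \<noteq> p k"
    proof
      assume "l x + e t = p k"
      then have "l x - p k = - e t" by (simp add: algebra_simps)
      then have "norm (l x - p k) = 2" using ne[of t] by simp
      with that show False by (simp add: W_def)
    qed
  qed (simp add: ne)
  have e_cont: "continuous_on S e" for S unfolding e_def by (intro continuous_intros)
  have comp_cont: "continuous_on (W k \<times> cbox 0 1) (\<lambda>(x, t). g (x + e t *s v))"
    if "continuous_on U g" for g :: "complex^'n \<Rightarrow> 'z::topological_space" and k
    unfolding case_prod_unfold
  proof (rule continuous_on_compose2[OF that])
    show "continuous_on (W k \<times> cbox 0 1) (\<lambda>y. fst y + e (snd y) *s v)"
      by (intro continuous_intros continuous_on_compose2[OF e_cont[of UNIV]]) auto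
    show "(\<lambda>y. fst y + e (snd y) *s v) ` (W k \<times> cbox 0 1) \<subseteq> U"
      using circle_in_U by auto
  qed
  have line_cont: "continuous_on (cbox 0 1) (\<lambda>t. g (x + e t *s v))"
    if "continuous_on U g" "x \<in> W k" for g :: "complex^'n \<Rightarrow> 'z::topological_space" and x k
    by (rule continuous_on_compose2[OF that(1)])
       (use circle_in_U[OF that(2)] in \<open>auto intro!: continuous_intros continuous_on_compose2[OF e_cont[of UNIV]]\<close>)
  have M_holo: "holo_on (W k) M" for k
  proof (rule holo_onI)
    fix x assume x: "x \<in> W k"
    have fdint: "(\<lambda>t. fd G (x + e t *s v)) integrable_on cbox 0 1"
      by (rule integrable_continuous[OF line_cont[OF continuous_on_fd[OF G U] x]])
    have "(M has_derivative integral (cbox 0 1) (\<lambda>t. fd G (x + e t *s v))) (at x within W k)"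
      unfolding M_def
    proof (rule leibniz_rule[OF _ _ _ x convW])
      fix y t assume y: "y \<in> W k"
      have "((\<lambda>y. y + e t *s v) has_derivative (\<lambda>h. h)) (at y)"
        by (auto intro!: derivative_eq_intros)
      from has_derivative_compose[OF this fd_has_derivative(1)[OF G circle_in_U[OF y]]]
      show "((\<lambda>y. G (y + e t *s v)) has_derivative fd G (y + e t *s v)) (at y within W k)"
        by (rule has_derivative_at_withinI)
      show "(\<lambda>t. G (y + e t *s v)) integrable_on cbox 0 1"
        by (rule integrable_continuous[OF line_cont[OF holo_on_continuous_on[OF G] y]])
    next
      show "continuous_on (W k \<times> cbox 0 1) (\<lambda>(x, t). fd G (x + e t *s v))"
        by (rule comp_cont[OF continuous_on_fd[OF G U]])
    qed
    then show "(M has_derivative integral (cbox 0 1) (\<lambda>t. fd G (x + e t *s v))) (at x)"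
      using at_within_open[OF x W] by simp
    show "integral (cbox 0 1) (\<lambda>t. fd G (x + e t *s v)) (d *s u)
          = d * integral (cbox 0 1) (\<lambda>t. fd G (x + e t *s v)) u" for d u
      by (simp add: blinfun_apply_integral[OF fdint] fd_has_derivative(2)[OF G circle_in_U[OF x]] del: box_real)
  qed
  have M_eq: "M x = G x" if x: "x \<in> W k" "x \<in> U" for x k
  proof -
    define \<zeta>0 where "\<zeta>0 = p k - l x"
    have \<zeta>0: "norm \<zeta>0 < 1" using x(1) by (simp add: W_def \<zeta>0_def norm_minus_commute)
    \<comment> \<open>The limit of the quotient by l'Hospital's rule: along \<open>v\<close> the
      denominator has derivative 1 at each of its zeros.\<close>
    define c where "c = fd N (x + \<zeta>0 *s v) v"
    define F where "F = (\<lambda>\<zeta>. if \<zeta> = \<zeta>0 then c else G (x + \<zeta> *s v))"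
    have exp0: "exp (- (l x + \<zeta>0)) = 1" unfolding exp_minus_eq_1_iff by (auto simp: \<zeta>0_def p_def)
    have "F holomorphic_on ball 0 3" unfolding F_def
    proof (rule removable_singularity)
      show "(\<lambda>\<zeta>. G (x + \<zeta> *s v)) holomorphic_on ball 0 3 - {\<zeta>0}"
        unfolding holomorphic_on_open[OF open_delete[OF open_ball]]
      proof
        fix \<zeta> assume "\<zeta> \<in> ball 0 3 - {\<zeta>0}"
        then have "x + \<zeta> *s v \<in> U" by (intro in_U[OF x(1)]) (auto simp: \<zeta>0_def algebra_simps)
        then show "\<exists>f'. ((\<lambda>\<zeta>. G (x + \<zeta> *s v)) has_field_derivative f') (at \<zeta>)"
          using holo_on_line[OF G] by blast
      qed
      show "(\<lambda>\<zeta>. G (x + \<zeta> *s v)) \<midarrow>\<zeta>0\<rightarrow> c"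
        unfolding G_def l_line
      proof (rule lhopital_complex_simple)
        show "((\<lambda>\<zeta>. N (x + \<zeta> *s v)) has_field_derivative c) (at \<zeta>0)"
          unfolding c_def by (rule holo_on_line[of UNIV]) (use N in \<open>auto simp: holo_iff\<close>)
        show "((\<lambda>\<zeta>. 1 - exp (- (l x + \<zeta>))) has_field_derivative 1) (at \<zeta>0)"
          using exp0 by (auto intro!: derivative_eq_intros)
        show "N (x + \<zeta>0 *s v) = 0"
          using exp0 l_line[of x \<zeta>0] by (intro zero) (simp add: l_def algebra_simps)
      qed (use exp0 in auto)
    qed auto
    then have "F holomorphic_on cball 0 2" by (rule holomorphic_on_subset) (auto simp: dist_norm)
    then have "F 0 = integral (cbox 0 1) (\<lambda>t. F (e t))"
      unfolding e_def
      by (intro circle_integral(1) holomorphic_on_imp_continuous_on)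
         (auto intro: holomorphic_on_subset[OF _ ball_subset_cball])
    also have "(\<lambda>t. F (e t)) = (\<lambda>t. G (x + e t *s v))"
    proof
      show "F (e t) = G (x + e t *s v)" for t using \<zeta>0 ne[of t] by (auto simp: F_def)
    qed
    finally have "F 0 = M x" by (simp add: M_def)
    moreover have "\<zeta>0 \<noteq> 0" using x(2) exp0 by (auto simp: U_def)
    ultimately show ?thesis by (simp add: F_def)
  qed
  \<comment> \<open>The two pieces agree on overlaps by \<open>M_eq\<close>, and the sets
    \<open>W k\<close> cover the complement of \<open>U\<close>.\<close>
  define q where "q = (\<lambda>x. if x \<in> U then G x else M x)"
  have qU: "holo_on U q" by (rule holo_on_transform[OF G U]) (simp add: q_def)
  have qW: "holo_on (W k) q" for k
    by (rule holo_on_transform[OF M_holo W]) (simp add: q_def M_eq)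
  have "holo q" unfolding holo_def
  proof
    fix x
    show "\<exists>L. (q has_derivative L) (at x) \<and> (\<forall>c v. L (c *s v) = c * L v)"
    proof (cases "x \<in> U")
      case True then show ?thesis using qU by (auto simp: holo_on_def)
    next
      case False
      then obtain k where "l x = p k" by (auto simp: U_def exp_minus_eq_1_iff p_def)
      then have "x \<in> W k" by (simp add: W_def)
      then show ?thesis using qW[of k] by (auto simp: holo_on_def)
    qed
  qed
  then show ?thesis
    by (intro exI[of _ q]) (auto simp: q_def U_def G_def l_def)
qed

section \<open>Root systems with a simple system\<close>

lemma bf_commute: "bf x y = bf y x"
  by (simp add: bf_def mult.commute)

lemma bf_add_left: "bf (x + y) z = bf x z + bf y z"
  and bf_add_right: "bf z (x + y) = bf z x + bf z y"
  and bf_diff_left: "bf (x - y) z = bf x z - bf y z"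
  and bf_diff_right: "bf z (x - y) = bf z x - bf z y"
  and bf_minus_left: "bf (- x) z = - bf x z"
  and bf_minus_right: "bf z (- x) = - bf z x"
  and bf_scale_left: "bf (c *s x) z = c * bf x z"
  and bf_scale_right: "bf z (c *s x) = c * bf z x"
  and bf_zero_left: "bf 0 z = 0"
  and bf_zero_right: "bf z 0 = 0"
  by (simp_all add: bf_def ring_distribs sum.distrib sum_subtractf sum_negf sum_distrib_left algebra_simps)

lemmas bf_simps = bf_add_left bf_add_right bf_diff_left bf_diff_right bf_minus_left bf_minus_right
  bf_scale_left bf_scale_right bf_zero_left bf_zero_right

lemma bf_sum_left: "bf (sum f A) z = (\<Sum>i\<in>A. bf (f i) z)"
  by (induction A rule: infinite_finite_induct) (auto simp: bf_simps)

lemma Re_bf_eq_inner: "real_vec x \<Longrightarrow> Re (bf x y) = x \<bullet> y"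
  by (auto simp: bf_def real_vec_def inner_vec_def inner_complex_def complex_is_Real_iff intro!: sum.cong)

lemma bf_eq_inner:
  assumes "real_vec x" "real_vec y" shows "bf x y = of_real (x \<bullet> y)"
proof (rule complex_eqI)
  show "Im (bf x y) = Im (of_real (x \<bullet> y))"
    using assms by (simp add: bf_def real_vec_def complex_is_Real_iff)
qed (simp add: Re_bf_eq_inner assms)

lemma vector_scalar_mult_linear_left: "(c + d) *s (x::complex^'n) = c *s x + d *s x"
  "(c - d) *s x = c *s x - d *s x" "(- c) *s x = - (c *s x)"
  by (simp_all add: vec_eq_iff algebra_simps)

lemma vector_scalar_mult_linear_right: "c *s (x + y :: complex^'n) = c *s x + c *s y"
  "c *s (x - y) = c *s x - c *s y" "c *s (- x) = - (c *s x)" "c *s (0::complex^'n) = 0"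
  by (simp_all add: vec_eq_iff algebra_simps)

lemma vector_scalar_mult_minus1: "(-1) *s (x::complex^'n) = - x"
  and vector_scalar_mult_2: "2 *s x = x + x"
  by (simp_all add: vec_eq_iff)

lemma refl_add: "refl a (x + y) = refl a x + refl a y"
  by (simp add: refl_def bf_simps vector_scalar_mult_linear_left)

lemma refl_scale: "refl a (c *s x) = c *s refl a x"
  by (simp add: refl_def bf_simps vector_scalar_mult_linear_right)

lemma bf_cor: "bf (cor a) x = 2 / bf a a * bf a x"
  by (simp add: cor_def bf_simps)

lemma refl_self: "bf a a \<noteq> 0 \<Longrightarrow> refl a a = - a"
  by (simp add: refl_def bf_cor vector_scalar_mult_2)

lemma bf_refl:
  assumes "bf a a \<noteq> 0" shows "bf (refl a x) (refl a y) = bf x y"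
proof -
  define k where "k = 2 / bf a a"
  have k: "k * bf a a = 2" using assms by (simp add: k_def)
  have "bf (refl a x) (refl a y) = bf x y - 2 * (k * bf a x * bf a y) + (k * bf a a) * (k * bf a x * bf a y)"
    unfolding refl_def bf_cor k_def[symmetric]
    by (simp add: bf_simps bf_commute[of x a] bf_commute[of y a]) (simp add: algebra_simps)
  then show ?thesis by (simp add: k)
qed

lemma refl_refl:
  assumes "bf a a \<noteq> 0" shows "refl a (refl a x) = x"
proof -
  have "bf (cor a) (refl a x) = - bf (cor a) x"
    using assms by (simp add: refl_def bf_cor bf_simps)
  then show ?thesis by (simp add: refl_def[of a "refl a x"] vector_scalar_mult_linear_left) (simp add: refl_def)
qed

locale based_root_system =
  fixes R :: "(complex^'n) set" and \<alpha> :: "'n \<Rightarrow> complex^'n" and b :: "'n \<Rightarrow> complex^'n"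
  assumes rs: "is_root_system R" and simple: "simple_system R \<alpha>"
    and dual: "\<And>i j. bf (\<alpha> j) (b i) = (if i = j then 1 else 0)"
begin

section \<open>Roots and the Weyl group\<close>

lemma finite_R: "finite R" and zero_notin: "0 \<notin> R"
  and root_real: "a \<in> R \<Longrightarrow> real_vec a"
  and refl_in: "a \<in> R \<Longrightarrow> c \<in> R \<Longrightarrow> refl a c \<in> R"
  and cor_int: "a \<in> R \<Longrightarrow> c \<in> R \<Longrightarrow> bf c (cor a) \<in> \<int>"
  and reduced: "a \<in> R \<Longrightarrow> z *s a \<in> R \<Longrightarrow> z = 1 \<or> z = -1"
  using rs unfolding is_root_system_def by blast+

lemma simple_in: "\<alpha> i \<in> R"
  using simple by (simp add: simple_system_def)

lemma root_inner_pos: "a \<in> R \<Longrightarrow> a \<bullet> a > 0"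
  using zero_notin by (metis inner_gt_zero_iff)

lemma bf_root: "a \<in> R \<Longrightarrow> c \<in> R \<Longrightarrow> bf a c = of_real (a \<bullet> c)"
  by (simp add: bf_eq_inner root_real)

lemma bf_root_nz: "a \<in> R \<Longrightarrow> bf a a \<noteq> 0"
  using root_inner_pos[of a] by (simp add: bf_root)

lemma neg_in: "a \<in> R \<Longrightarrow> - a \<in> R"
  using refl_in[of a a] by (simp add: refl_self bf_root_nz)

lemma weyl_add: "w \<in> weyl R \<Longrightarrow> w (x + y) = w x + w y"
  by (induction rule: weyl.induct) (auto simp: refl_add)

lemma weyl_scale: "w \<in> weyl R \<Longrightarrow> w (c *s x) = c *s w x"
  by (induction rule: weyl.induct) (auto simp: refl_scale)

lemma weyl_minus: "w \<in> weyl R \<Longrightarrow> w (- x) = - w x"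
  using weyl_scale[of w "-1" x] by (simp add: vector_scalar_mult_minus1)

lemma weyl_diff: "w \<in> weyl R \<Longrightarrow> w (x - y) = w x - w y"
  using weyl_add[of w x "- y"] by (simp add: weyl_minus)

lemma weyl_scaleR: "w \<in> weyl R \<Longrightarrow> w (r *\<^sub>R x) = r *\<^sub>R w x"
  by (simp add: scaleR_eq_vector_scalar_mult weyl_scale)

lemma weyl_zero: "w \<in> weyl R \<Longrightarrow> w 0 = 0"
  using weyl_scale[of w 0 0] by simp

lemma weyl_sum: "w \<in> weyl R \<Longrightarrow> w (sum f A) = (\<Sum>i\<in>A. w (f i))"
  by (induction A rule: infinite_finite_induct) (auto simp: weyl_add weyl_zero)

lemma weyl_bf: "w \<in> weyl R \<Longrightarrow> bf (w x) (w y) = bf x y"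
  by (induction rule: weyl.induct) (auto simp: bf_refl bf_root_nz)

lemma weyl_root: "w \<in> weyl R \<Longrightarrow> a \<in> R \<Longrightarrow> w a \<in> R"
  by (induction rule: weyl.induct) (auto simp: refl_in)

lemma weyl_compose: "w \<in> weyl R \<Longrightarrow> v \<in> weyl R \<Longrightarrow> w \<circ> v \<in> weyl R"
  by (induction rule: weyl.induct) (auto intro: weyl.intros simp: comp_assoc)

lemma refl_weyl: "a \<in> R \<Longrightarrow> refl a \<in> weyl R"
  using weyl_step[OF _ weyl_id] by simp

lemma weyl_inverse:
  "w \<in> weyl R \<Longrightarrow> \<exists>v\<in>weyl R. (\<forall>x. v (w x) = x) \<and> (\<forall>x. w (v x) = x)"
proof (induction rule: weyl.induct)
  case weyl_id
  then show ?case by (auto intro!: bexI[of _ id] weyl.weyl_id)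
next
  case (weyl_step a w)
  then obtain v where "v \<in> weyl R" "\<forall>x. v (w x) = x" "\<forall>x. w (v x) = x" by blast
  with weyl_step show ?case
    by (intro bexI[of _ "v \<circ> refl a"] weyl_compose refl_weyl) (auto simp: refl_refl bf_root_nz)
qed

lemma weyl_cor: "w \<in> weyl R \<Longrightarrow> cor (w a) = w (cor a)"
  by (simp add: cor_def weyl_bf weyl_scale)

text \<open>Coordinates are read off with the fundamental coweights \<open>b\<close>, so their
  linearity is immediate and linear independence of the simple roots needs no argument. The real
  part makes them ordered numbers; on roots it loses nothing, see \<open>bf_b\<close>.\<close>

definition co :: "complex^'n \<Rightarrow> 'n \<Rightarrow> real" where "co x i = Re (bf x (b i))"

lemma co_add: "co (x + y) i = co x i + co y i" and co_diff: "co (x - y) i = co x i - co y i"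
  and co_minus: "co (- x) i = - co x i" and co_scaleR: "co (r *\<^sub>R x) i = r * co x i"
  and co_zero: "co 0 i = 0"
  by (simp_all add: co_def bf_simps scaleR_eq_vector_scalar_mult)

lemma co_sum: "co (sum f A) i = (\<Sum>j\<in>A. co (f j) i)"
  by (simp add: co_def bf_sum_left)

lemmas co_simps = co_add co_diff co_minus co_scaleR co_zero co_sum

lemma co_simple: "co (\<alpha> j) i = (if i = j then 1 else 0)"
  by (simp add: co_def dual)

lemma of_nat_scale: "of_nat k *s (x::complex^'n) = real k *\<^sub>R x"
  by (simp add: scaleR_eq_vector_scalar_mult)

lemma nncomb_expand:
  assumes "nncomb \<alpha> K x"
  shows "x = (\<Sum>i\<in>UNIV. co x i *\<^sub>R \<alpha> i)" "co x i \<in> \<int>" "co x i \<ge> 0" "i \<notin> K \<Longrightarrow> co x i = 0"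
proof -
  obtain c :: "'n \<Rightarrow> nat" where c: "x = (\<Sum>j\<in>K. of_nat (c j) *s \<alpha> j)"
    using assms by (auto simp: nncomb_def)
  have co: "co x i = (if i \<in> K then real (c i) else 0)" for i
    unfolding c of_nat_scale co_sum co_scaleR co_simple by (simp add: if_distrib cong: if_cong)
  show "co x i \<in> \<int>" "co x i \<ge> 0" "i \<notin> K \<Longrightarrow> co x i = 0" by (simp_all add: co)
  have "(\<Sum>i\<in>UNIV. co x i *\<^sub>R \<alpha> i) = (\<Sum>i\<in>UNIV. if i \<in> K then real (c i) *\<^sub>R \<alpha> i else 0)"
    by (rule sum.cong) (auto simp: co)
  also have "\<dots> = x" by (simp add: c of_nat_scale flip: sum.inter_filter)
  finally show "x = (\<Sum>i\<in>UNIV. co x i *\<^sub>R \<alpha> i)" by simp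
qed

lemma nncombI:
  assumes "x = (\<Sum>i\<in>UNIV. co x i *\<^sub>R \<alpha> i)" "\<And>i. co x i \<in> \<int>" "\<And>i. co x i \<ge> 0"
    "\<And>i. i \<notin> K \<Longrightarrow> co x i = 0"
  shows "nncomb \<alpha> K x"
proof -
  have c: "real (nat \<lfloor>co x i\<rfloor>) = co x i" for i
    using assms(2)[of i] assms(3)[of i] by (auto elim: Ints_cases)
  have "(\<Sum>j\<in>K. of_nat (nat \<lfloor>co x j\<rfloor>) *s \<alpha> j) = (\<Sum>j\<in>K. co x j *\<^sub>R \<alpha> j)"
    by (simp only: of_nat_scale c)
  also have "\<dots> = (\<Sum>i\<in>UNIV. co x i *\<^sub>R \<alpha> i)"
    by (rule sum.mono_neutral_left) (auto simp: assms(4))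
  finally have "x = (\<Sum>j\<in>K. of_nat (nat \<lfloor>co x j\<rfloor>) *s \<alpha> j)" using assms(1) by simp
  then show ?thesis unfolding nncomb_def by (rule exI[where x = "\<lambda>j. nat \<lfloor>co x j\<rfloor>"])
qed

lemma root_expand:
  assumes "a \<in> R"
  shows "a = (\<Sum>i\<in>UNIV. co a i *\<^sub>R \<alpha> i)" and co_Ints: "co a i \<in> \<int>"
    and co_sign: "(\<forall>i. co a i \<ge> 0) \<or> (\<forall>i. co a i \<le> 0)"
proof -
  consider "nncomb \<alpha> UNIV a" | "nncomb \<alpha> UNIV (- a)" using simple assms by (auto simp: simple_system_def)
  then have "a = (\<Sum>i\<in>UNIV. co a i *\<^sub>R \<alpha> i) \<and> (\<forall>i. co a i \<in> \<int>) \<and> ((\<forall>i. co a i \<ge> 0) \<or> (\<forall>i. co a i \<le> 0))"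
  proof cases
    case 1
    from nncomb_expand[OF this] show ?thesis by auto
  next
    case 2
    note c = nncomb_expand[OF this]
    have "- a = - (\<Sum>i\<in>UNIV. co a i *\<^sub>R \<alpha> i)" using c(1) by (simp add: co_minus sum_negf)
    moreover have "co a i \<in> \<int>" for i using c(2)[of i] by (simp add: co_minus)
    moreover have "co a i \<le> 0" for i using c(3)[of i] by (simp add: co_minus)
    ultimately show ?thesis by simp
  qed
  then show "a = (\<Sum>i\<in>UNIV. co a i *\<^sub>R \<alpha> i)" "co a i \<in> \<int>"
    "(\<forall>i. co a i \<ge> 0) \<or> (\<forall>i. co a i \<le> 0)" by auto
qed

abbreviation Pos where "Pos \<equiv> pos_roots R \<alpha>"

lemma pos_iff: "a \<in> Pos \<longleftrightarrow> a \<in> R \<and> (\<forall>i. co a i \<ge> 0)"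
proof
  assume "a \<in> Pos"
  then have "a \<in> R" "nncomb \<alpha> UNIV a" by (auto simp: pos_roots_def)
  then show "a \<in> R \<and> (\<forall>i. co a i \<ge> 0)" by (simp add: nncomb_expand(3))
next
  assume a: "a \<in> R \<and> (\<forall>i. co a i \<ge> 0)"
  then have "nncomb \<alpha> UNIV a" by (intro nncombI root_expand(1) co_Ints) auto
  with a show "a \<in> Pos" by (simp add: pos_roots_def)
qed

lemma pos_in: "a \<in> Pos \<Longrightarrow> a \<in> R" and pos_co: "a \<in> Pos \<Longrightarrow> co a i \<ge> 0"
  by (auto simp: pos_iff)

lemma pos_or_neg: "a \<in> R \<Longrightarrow> a \<in> Pos \<or> - a \<in> Pos"
  using co_sign[of a] neg_in[of a] by (auto simp: pos_iff co_minus)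

lemma simple_pos: "\<alpha> i \<in> Pos"
  by (simp add: pos_iff simple_in co_simple)

lemma ex_co_nonzero: "a \<in> R \<Longrightarrow> \<exists>i. co a i \<noteq> 0"
proof (rule ccontr)
  assume a: "a \<in> R" "\<not> ?thesis"
  then have "(\<Sum>i\<in>UNIV. co a i *\<^sub>R \<alpha> i) = 0" by simp
  with root_expand(1)[OF a(1)] zero_notin a(1) show False by simp
qed

lemma not_pos_and_neg: "a \<in> Pos \<Longrightarrow> - a \<notin> Pos"
proof
  assume a: "a \<in> Pos" "- a \<in> Pos"
  then have "co a i = 0" for i using pos_co[OF a(1), of i] pos_co[OF a(2), of i] by (simp add: co_minus)
  then show False using ex_co_nonzero[OF pos_in[OF a(1)]] by simp
qed

lemma pos_if_co: "a \<in> R \<Longrightarrow> co a i > 0 \<Longrightarrow> a \<in> Pos"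
  using co_sign[of a] unfolding pos_iff by (meson not_le)

section \<open>Heights and images of simple roots\<close>

definition ht :: "complex^'n \<Rightarrow> real" where "ht x = (\<Sum>i\<in>UNIV. co x i)"

lemma ht_add: "ht (x + y) = ht x + ht y" and ht_diff: "ht (x - y) = ht x - ht y"
  and ht_scaleR: "ht (r *\<^sub>R x) = r * ht x"
  by (simp_all add: ht_def co_simps sum.distrib sum_subtractf sum_negf sum_distrib_left)

lemma ht_sum: "ht (sum f A) = (\<Sum>j\<in>A. ht (f j))"
  unfolding ht_def co_sum by (rule sum.swap)

lemma ht_simple: "ht (\<alpha> i) = 1"
  by (simp add: ht_def co_simple)

lemma co_ge_1: "a \<in> R \<Longrightarrow> co a i > 0 \<Longrightarrow> co a i \<ge> 1"
  using co_Ints[of a i] by (auto elim!: Ints_cases)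

lemma ht_ge_1: assumes "a \<in> Pos" shows "ht a \<ge> 1"
proof -
  obtain i where "co a i \<noteq> 0" using assms ex_co_nonzero pos_in by blast
  then have "co a i \<ge> 1" using co_ge_1[of a i] pos_co[OF assms, of i] pos_in[OF assms] by linarith
  also have "co a i \<le> ht a" unfolding ht_def by (rule member_le_sum) (auto simp: pos_co assms)
  finally show ?thesis .
qed

lemma co_eqI:
  assumes "a \<in> R" "c \<in> R" "\<And>i. co a i = co c i" shows "a = c"
  using root_expand(1)[OF assms(1)] root_expand(1)[OF assms(2)] assms(3) by simp

text \<open>Compare heights: every positive root has height at least 1.\<close>
lemma simple_image:
  assumes w: "w \<in> weyl R" and g: "g \<in> Pos" and pos: "\<And>i. co g i > 0 \<Longrightarrow> w (\<alpha> i) \<in> Pos"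
    and eq: "w g = \<alpha> k"
  shows "\<exists>i. g = \<alpha> i"
proof -
  have gR: "g \<in> R" by (rule pos_in[OF g])
  have "w g = (\<Sum>i\<in>UNIV. co g i *\<^sub>R w (\<alpha> i))"
    using arg_cong[OF root_expand(1)[OF gR], of w] by (simp add: weyl_sum weyl_scaleR w)
  then have "1 = (\<Sum>i\<in>UNIV. co g i * ht (w (\<alpha> i)))"
    using ht_simple[of k] by (simp add: eq ht_sum ht_scaleR)
  also have "\<dots> \<ge> (\<Sum>i\<in>UNIV. co g i)"
  proof (rule sum_mono)
    fix i
    show "co g i \<le> co g i * ht (w (\<alpha> i))"
    proof (cases "co g i > 0")
      case True
      then show ?thesis using ht_ge_1[OF pos[OF True]] by simp
    next
      case False
      then show ?thesis using pos_co[OF g, of i] by simp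
    qed
  qed
  finally have ht: "ht g \<le> 1" by (simp add: ht_def)
  \<comment> \<open>Nonnegative integers, not all zero, with sum at most 1: exactly one of them is
    1.\<close>
  obtain i where "co g i \<noteq> 0" using ex_co_nonzero[OF gR] by blast
  then have i: "co g i \<ge> 1" using co_ge_1[OF gR, of i] pos_co[OF g, of i] by linarith
  have "ht g = co g i + (\<Sum>j\<in>UNIV-{i}. co g j)" unfolding ht_def by (simp add: sum.remove)
  with ht i have "(\<Sum>j\<in>UNIV-{i}. co g j) \<le> 0" "co g i \<le> 1"
    using sum_nonneg[of "UNIV - {i}" "co g"] pos_co[OF g] by auto
  moreover have "(\<Sum>j\<in>UNIV-{i}. co g j) \<ge> 0" by (rule sum_nonneg) (rule pos_co[OF g])
  ultimately have "\<forall>j\<in>UNIV-{i}. co g j = 0"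
    using sum_nonneg_eq_0_iff[of "UNIV - {i}" "co g"] pos_co[OF g] by simp
  then have "g = \<alpha> i"
    using i \<open>co g i \<le> 1\<close> by (intro co_eqI gR simple_in) (auto simp: co_simple)
  then show ?thesis ..
qed

lemma refl_eq_inner: "a \<in> R \<Longrightarrow> c \<in> R \<Longrightarrow> refl a c = c - (2 * (a \<bullet> c) / (a \<bullet> a)) *\<^sub>R a"
  by (simp add: refl_def bf_cor bf_root scaleR_eq_vector_scalar_mult)

text \<open>Since the system is reduced, \<open>g\<close> has a positive coordinate away from
  \<open>j\<close>. The reflection changes only coordinate \<open>j\<close>, and one positive
  coordinate makes a root positive.\<close>

lemma refl_simple_pos:
  assumes "g \<in> Pos" "g \<noteq> \<alpha> j" shows "refl (\<alpha> j) g \<in> Pos"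
proof -
  have gR: "g \<in> R" by (rule pos_in[OF assms(1)])
  have rR: "refl (\<alpha> j) g \<in> R" by (rule refl_in[OF simple_in gR])
  have "\<exists>i. i \<noteq> j \<and> co g i \<noteq> 0"
  proof (rule ccontr)
    assume "\<not> ?thesis"
    then have 0: "\<And>i. i \<noteq> j \<Longrightarrow> co g i = 0" by blast
    have "g = (\<Sum>i\<in>UNIV. co g i *\<^sub>R \<alpha> i)" by (rule root_expand(1)[OF gR])
    also have "\<dots> = (\<Sum>i\<in>{j}. co g i *\<^sub>R \<alpha> i)" by (rule sum.mono_neutral_right) (auto simp: 0)
    finally have g: "g = of_real (co g j) *s \<alpha> j" by (simp add: scaleR_eq_vector_scalar_mult)
    then have "complex_of_real (co g j) = 1 \<or> complex_of_real (co g j) = -1"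
      using gR by (intro reduced[OF simple_in[of j]]) simp
    then have "co g j = 1 \<or> co g j = -1"
      by (simp add: complex_eq_iff)
    then have "co g j = 1" using pos_co[OF assms(1), of j] by auto
    with g assms(2) show False by (simp add: vec_eq_iff)
  qed
  then obtain i where i: "i \<noteq> j" "co g i \<noteq> 0" by blast
  then have "co (refl (\<alpha> j) g) i > 0"
    using pos_co[OF assms(1), of i] by (simp add: refl_eq_inner simple_in gR co_simps co_simple)
  then show ?thesis by (rule pos_if_co[OF rR])
qed

end

section \<open>Highest roots of irreducible components\<close>

context based_root_system
begin

abbreviation RJ :: "'n set \<Rightarrow> (complex^'n) set" where "RJ \<equiv> R0 R \<alpha>"

lemma RJ_iff: "a \<in> RJ J \<longleftrightarrow> a \<in> R \<and> (\<forall>i. i \<notin> J \<longrightarrow> co a i = 0)"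
proof
  assume a: "a \<in> RJ J"
  have "co a i = 0" if "i \<notin> J" for i
  proof (rule span_induct[where S = "\<alpha> ` J" and P = "\<lambda>x. co x i = 0"])
    show "a \<in> span (\<alpha> ` J)" using a by (simp add: R0_def)
    show "subspace {x. co x i = 0}" by (auto simp: subspace_def co_simps)
  qed (use that in \<open>auto simp: co_simple\<close>)
  with a show "a \<in> R \<and> (\<forall>i. i \<notin> J \<longrightarrow> co a i = 0)" by (simp add: R0_def)
next
  assume a: "a \<in> R \<and> (\<forall>i. i \<notin> J \<longrightarrow> co a i = 0)"
  then have "(\<Sum>i\<in>UNIV. co a i *\<^sub>R \<alpha> i) = (\<Sum>i\<in>J. co a i *\<^sub>R \<alpha> i)"
    by (intro sum.mono_neutral_right) auto
  also have "\<dots> \<in> span (\<alpha> ` J)" by (intro span_sum span_scale span_base) auto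
  finally show "a \<in> RJ J" using a root_expand(1)[of a] by (simp add: R0_def)
qed

lemma RJ_in: "a \<in> RJ J \<Longrightarrow> a \<in> R" and RJ_co: "a \<in> RJ J \<Longrightarrow> i \<notin> J \<Longrightarrow> co a i = 0"
  by (auto simp: RJ_iff)

lemma simple_RJ: "j \<in> J \<Longrightarrow> \<alpha> j \<in> RJ J"
  by (auto simp: RJ_iff simple_in co_simple)

lemma neg_RJ: "a \<in> RJ J \<Longrightarrow> - a \<in> RJ J"
  by (auto simp: RJ_iff neg_in co_minus)

lemma refl_RJ: "a \<in> RJ J \<Longrightarrow> c \<in> RJ J \<Longrightarrow> refl a c \<in> RJ J"
  using refl_in[of a c] by (auto simp: RJ_iff) (simp add: refl_eq_inner co_simps)

text \<open>Both Cartan integers of the pair are positive. If one of them is 1, the corresponding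
  reflection produces the difference up to sign. If both are at least 2, then
  \<open>a \<bullet> c\<close> is at least both squared lengths, which forces a = c.\<close>

lemma root_diff:
  assumes a: "a \<in> R" and c: "c \<in> R" and pos: "a \<bullet> c > 0" and ne: "a \<noteq> c"
  shows "a - c \<in> R"
proof -
  have int: "2 * (x \<bullet> y) / (y \<bullet> y) \<in> \<int>" if "x \<in> R" "y \<in> R" for x y
  proof -
    have "bf x (cor y) = of_real (2 * (x \<bullet> y) / (y \<bullet> y))"
      using that by (simp add: cor_def bf_simps bf_root)
    moreover have "bf x (cor y) \<in> \<int>" using cor_int that by blast
    ultimately show ?thesis by (metis Ints_cases Ints_of_int of_real_eq_iff of_real_of_int_eq)
  qed
  have ge2: "x \<bullet> y \<ge> y \<bullet> y \<or> 2 * (x \<bullet> y) / (y \<bullet> y) = 1" if xy: "x \<in> R" "y \<in> R" "x \<bullet> y > 0" for x y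
  proof -
    obtain k :: int where k: "2 * (x \<bullet> y) / (y \<bullet> y) = of_int k"
      using int[OF xy(1,2)] by (auto elim: Ints_cases)
    have yy: "y \<bullet> y > 0" by (rule root_inner_pos[OF xy(2)])
    then have "2 * (x \<bullet> y) / (y \<bullet> y) > 0" using xy(3) by simp
    then have "k > 0" using k by simp
    then consider "k = 1" | "k \<ge> 2" by linarith
    then show ?thesis
    proof cases
      case 2
      then have "2 * (x \<bullet> y) / (y \<bullet> y) \<ge> 2" using k by simp
      then show ?thesis using yy by (simp add: field_simps)
    qed (use k in simp)
  qed
  consider "2 * (a \<bullet> c) / (c \<bullet> c) = 1" | "2 * (c \<bullet> a) / (a \<bullet> a) = 1" | "a \<bullet> c \<ge> c \<bullet> c" "c \<bullet> a \<ge> a \<bullet> a"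
    using ge2[OF a c pos] ge2[OF c a] pos by (auto simp: inner_commute)
  then show ?thesis
  proof cases
    case 1
    then have "2 * (c \<bullet> a) / (c \<bullet> c) = 1" by (simp only: inner_commute[of c a])
    then have "refl c a = a - c" by (simp only: refl_eq_inner[OF c a] scaleR_one)
    then show ?thesis using refl_in[OF c a] by simp
  next
    case 2
    then have "2 * (a \<bullet> c) / (a \<bullet> a) = 1" by (simp only: inner_commute[of a c])
    then have "refl a c = c - a" by (simp only: refl_eq_inner[OF a c] scaleR_one)
    then show ?thesis using neg_in[OF refl_in[OF a c]] by simp
  next
    case 3
    then have "(a - c) \<bullet> (a - c) \<le> 0" by (simp add: inner_diff inner_commute algebra_simps)
    then have "a - c = 0" by (metis inner_ge_zero inner_eq_zero_iff antisym)
    with ne show ?thesis by simp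
  qed
qed

text \<open>Otherwise the difference would be a root with coordinates 1 and -1.\<close>

lemma simple_obtuse: assumes "i \<noteq> j" shows "\<alpha> i \<bullet> \<alpha> j \<le> 0"
proof (rule ccontr)
  assume "\<not> ?thesis"
  moreover have "\<alpha> i \<noteq> \<alpha> j" using co_simple[of i i] co_simple[of j i] assms by auto
  ultimately have "\<alpha> i - \<alpha> j \<in> R" by (intro root_diff simple_in) auto
  from co_sign[OF this] show False using assms
    by (auto simp: co_simps co_simple dest!: spec[of _ i] spec[of _ j] split: if_splits)
qed

lemma RJ_expand:
  assumes "a \<in> RJ J" shows "a = (\<Sum>i\<in>J. co a i *\<^sub>R \<alpha> i)"
proof -
  have "(\<Sum>i\<in>UNIV. co a i *\<^sub>R \<alpha> i) = (\<Sum>i\<in>J. co a i *\<^sub>R \<alpha> i)"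
    by (rule sum.mono_neutral_right) (auto simp: RJ_co[OF assms])
  then show ?thesis using root_expand(1)[OF RJ_in[OF assms]] by simp
qed

text \<open>Such an \<open>e\<close> is orthogonal to itself, hence 0, and \<open>co\<close> then
  reads off the coefficients. It serves to show that the part of a root along certain simple roots
  is absent.\<close>

lemma combination_eq_0:
  assumes "e = (\<Sum>i\<in>A. f i *\<^sub>R \<alpha> i)" and "\<And>i. i \<in> A \<Longrightarrow> e \<bullet> \<alpha> i = 0" and "i \<in> A"
  shows "f i = 0"
proof -
  have "e \<bullet> e = (\<Sum>i\<in>A. f i * (e \<bullet> \<alpha> i))"
    by (subst (2) assms(1)) (simp add: inner_sum_right)
  also have "\<dots> = 0" by (rule sum.neutral) (simp add: assms(2))
  finally have "e = 0" by simp
  then have "0 = co (\<Sum>j\<in>A. f j *\<^sub>R \<alpha> j) i" using assms(1) by (simp add: co_zero)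
  also have "\<dots> = f i" using assms(3) by (simp add: co_simps co_simple if_distrib cong: if_cong)
  finally show ?thesis by simp
qed

section \<open>Maximal roots for the coordinatewise order\<close>

definition le_co :: "complex^'n \<Rightarrow> complex^'n \<Rightarrow> bool" where
  "le_co x y \<longleftrightarrow> (\<forall>i. co x i \<le> co y i)"

lemma root_le_cases: "a - c \<in> R \<Longrightarrow> le_co a c \<or> le_co c a"
  using co_sign[of "a - c"] by (auto simp: le_co_def co_diff)

text \<open>Among the finitely many roots above \<open>c\<close> take one of greatest height:
  anything above it has the same height, hence the same coordinates.\<close>

lemma ex_maximal_above:
  assumes "C \<subseteq> R" "c \<in> C"
  shows "\<exists>m\<in>C. le_co c m \<and> (\<forall>d\<in>C. le_co m d \<longrightarrow> d = m)"
proof -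
  define F where "F = {d \<in> C. le_co c d}"
  have "finite F" "F \<noteq> {}"
    using assms finite_subset[OF assms(1) finite_R] by (auto simp: F_def le_co_def)
  then have "Max (ht ` F) \<in> ht ` F" by (intro Max_in) auto
  then obtain m where m: "m \<in> F" and "Max (ht ` F) = ht m" by auto
  then have max: "ht d \<le> ht m" if "d \<in> F" for d
    using Max_ge[of "ht ` F" "ht d"] that \<open>finite F\<close> by simp
  have "d = m" if d: "d \<in> C" "le_co m d" for d
  proof (rule co_eqI)
    show "d \<in> R" "m \<in> R" using d m assms(1) by (auto simp: F_def)
    have "d \<in> F" using d m by (auto simp: F_def le_co_def intro: order_trans)
    then have le: "ht d \<le> ht m" by (rule max)
    have "(\<Sum>i\<in>UNIV. co d i - co m i) \<le> 0" using le by (simp add: ht_def sum_subtractf)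
    moreover have "(\<Sum>i\<in>UNIV. co d i - co m i) \<ge> 0" using d(2) by (intro sum_nonneg) (simp add: le_co_def)
    ultimately have "\<forall>i\<in>UNIV. co d i - co m i = 0"
      using d(2) by (subst sum_nonneg_eq_0_iff[symmetric]) (auto simp: le_co_def)
    then show "co d i = co m i" for i by simp
  qed
  with m show ?thesis by (auto simp: F_def)
qed

definition maximal_in :: "(complex^'n) set \<Rightarrow> complex^'n \<Rightarrow> bool" where
  "maximal_in C m \<longleftrightarrow> m \<in> C \<and> (\<forall>d\<in>C. le_co m d \<longrightarrow> d = m)"

text \<open>Closure under non-orthogonality is all that the facts about maximal roots use;
  connectedness enters with the induction along chains in
  \<open>highest_root_component\<close>.\<close>

definition union_of_components :: "'n set \<Rightarrow> (complex^'n) set \<Rightarrow> bool" where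
  "union_of_components J C \<longleftrightarrow> C \<subseteq> RJ J \<and> (\<forall>c\<in>C. \<forall>d\<in>RJ J. c \<bullet> d \<noteq> 0 \<longrightarrow> d \<in> C)"

context
  fixes J :: "'n set" and C :: "(complex^'n) set"
  assumes C: "union_of_components J C"
begin

lemma C_sub: "C \<subseteq> RJ J" and C_closed: "c \<in> C \<Longrightarrow> d \<in> RJ J \<Longrightarrow> c \<bullet> d \<noteq> 0 \<Longrightarrow> d \<in> C"
  using C by (auto simp: union_of_components_def)

lemma C_R: "c \<in> C \<Longrightarrow> c \<in> R"
  using C_sub RJ_in by blast

lemma C_neg: "c \<in> C \<Longrightarrow> - c \<in> C"
  using C_sub C_R[of c] root_inner_pos[of c] by (intro C_closed[of c "- c"] neg_RJ) auto

lemma maximal_pos: assumes "maximal_in C m" shows "m \<in> Pos"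
proof (rule ccontr)
  assume "m \<notin> Pos"
  have m: "m \<in> C" using assms by (simp add: maximal_in_def)
  then have neg: "- m \<in> Pos" using pos_or_neg[OF C_R[OF m]] \<open>m \<notin> Pos\<close> by blast
  then have "le_co m (- m)" unfolding le_co_def using pos_co[OF neg] by (simp add: co_minus)
  then have "- m = m" using assms C_neg[OF m] by (auto simp: maximal_in_def)
  with neg \<open>m \<notin> Pos\<close> show False by simp
qed

text \<open>If the product were negative, reflecting \<open>m\<close> in the simple root would raise
  it. The reflected root stays in \<open>C\<close> because it is linked to \<open>m\<close> through
  \<open>\<alpha> j\<close>, which is orthogonal to neither.\<close>

lemma maximal_dominant: assumes "maximal_in C m" "j \<in> J" shows "m \<bullet> \<alpha> j \<ge> 0"
proof (rule ccontr)
  assume neg: "\<not> ?thesis"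
  have m: "m \<in> C" "m \<in> RJ J" "m \<in> R" using assms C_sub C_R by (auto simp: maximal_in_def)
  have aC: "\<alpha> j \<in> C" using neg by (intro C_closed[OF m(1)] simple_RJ assms) auto
  define k where "k = - (2 * (\<alpha> j \<bullet> m) / (\<alpha> j \<bullet> \<alpha> j))"
  have k: "k > 0" using neg root_inner_pos[OF simple_in[of j]]
    by (simp add: k_def inner_commute divide_neg_pos)
  have r: "refl (\<alpha> j) m = m + k *\<^sub>R \<alpha> j"
    by (simp add: refl_eq_inner simple_in m k_def)
  have "\<alpha> j \<bullet> refl (\<alpha> j) m = - (\<alpha> j \<bullet> m)"
    using root_inner_pos[OF simple_in[of j]] by (simp only: r inner_add_right) (simp add: k_def)
  then have "refl (\<alpha> j) m \<in> C"
    using neg by (intro C_closed[OF aC] refl_RJ simple_RJ m assms) (auto simp: inner_commute)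
  moreover have "le_co m (refl (\<alpha> j) m)" using k by (simp add: r le_co_def co_simps co_simple)
  ultimately have "refl (\<alpha> j) m = m" using assms by (auto simp: maximal_in_def)
  then have "k *\<^sub>R \<alpha> j = 0" using r by simp
  with k show False using zero_notin simple_in[of j] by auto
qed

text \<open>A positive product would make the difference a root, hence the two maximal roots
  comparable. Dominance makes every term of the expansion of \<open>m \<bullet> d\<close>
  nonnegative, so all terms vanish.\<close>

lemma maximal_inner:
  assumes m: "maximal_in C m" and d: "maximal_in C d" and ne: "m \<noteq> d"
  shows "m \<bullet> d = 0" and "j \<in> J \<Longrightarrow> co d j > 0 \<Longrightarrow> m \<bullet> \<alpha> j = 0"
proof -
  have dC: "d \<in> RJ J" and mR: "m \<in> R" and dR: "d \<in> R" using m d C_sub C_R by (auto simp: maximal_in_def)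
  have eq: "m \<bullet> d = (\<Sum>j\<in>J. co d j * (m \<bullet> \<alpha> j))"
    by (subst RJ_expand[OF dC]) (simp add: inner_sum_right)
  have nn: "co d j * (m \<bullet> \<alpha> j) \<ge> 0" if "j \<in> J" for j
    using maximal_dominant[OF m that] pos_co[OF maximal_pos[OF d]] by simp
  have "m \<bullet> d \<le> 0"
  proof (rule ccontr)
    assume "\<not> m \<bullet> d \<le> 0"
    then have "m - d \<in> R" using mR dR ne by (intro root_diff) auto
    then have "le_co m d \<or> le_co d m" by (rule root_le_cases)
    with m d ne show False by (auto simp: maximal_in_def)
  qed
  moreover have "m \<bullet> d \<ge> 0" unfolding eq by (rule sum_nonneg) (rule nn)
  ultimately show 0: "m \<bullet> d = 0" by simp
  assume j: "j \<in> J" "co d j > 0"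
  have "\<forall>j\<in>J. co d j * (m \<bullet> \<alpha> j) = 0"
    using 0 nn unfolding eq by (subst sum_nonneg_eq_0_iff[symmetric]) auto
  with j show "m \<bullet> \<alpha> j = 0" by force
qed

text \<open>Two different maximal roots are orthogonal and dominant, so their supports are disjoint and orthogonal.\<close>
lemma maximal_supports_orthogonal:
  assumes m: "maximal_in C m" and d: "maximal_in C d" and ne: "m \<noteq> d"
    and i: "co m i > 0" and j: "co d j > 0"
  shows "\<alpha> i \<bullet> \<alpha> j = 0"
proof -
  have mC: "m \<in> RJ J" and dC: "d \<in> RJ J" using m d C_sub by (auto simp: maximal_in_def)
  have in_J: "i \<in> J" if "co m i > 0 \<or> co d i > 0" for i
    using that RJ_co[OF mC] RJ_co[OF dC] by force
  have m0: "co m i \<ge> 0" and d0: "co d i \<ge> 0" for i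
    using pos_co[OF maximal_pos] m d by auto
  \<comment> \<open>For \<open>j\<close> outside the support of \<open>m\<close>, the sum expressing
    \<open>m \<bullet> \<alpha> j\<close> has only nonpositive terms, since distinct simple roots
    are obtuse; its value is 0, so each term is.\<close>
  have orth: "\<alpha> i \<bullet> \<alpha> j = 0" if i: "co m i > 0" and j: "co d j > 0" "\<not> co m j > 0" for i j
  proof -
    have jJ: "j \<in> J" by (rule in_J) (simp add: j)
    have "0 = m \<bullet> \<alpha> j" using maximal_inner(2)[OF m d ne jJ j(1)] by simp
    also have "\<dots> = (\<Sum>i\<in>J. co m i * (\<alpha> i \<bullet> \<alpha> j))"
      by (subst RJ_expand[OF mC]) (simp add: inner_sum_left)
    finally have s: "(\<Sum>i\<in>J. - (co m i * (\<alpha> i \<bullet> \<alpha> j))) = 0" by (simp add: sum_negf)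
    have "- (co m i * (\<alpha> i \<bullet> \<alpha> j)) \<ge> 0" for i
    proof (cases "co m i > 0")
      case True
      with j have "i \<noteq> j" by auto
      then show ?thesis using simple_obtuse[of i j] True by (simp add: mult_le_0_iff)
    next
      case False
      then have "co m i = 0" using m0[of i] by simp
      then show ?thesis by simp
    qed
    then have "\<forall>i\<in>J. - (co m i * (\<alpha> i \<bullet> \<alpha> j)) = 0"
      using s by (subst sum_nonneg_eq_0_iff[symmetric]) auto
    with i in_J[of i] show ?thesis by force
  qed
  \<comment> \<open>\<open>A\<close> is the common support and \<open>e\<close> the part of
    \<open>d\<close> on it. The rest of \<open>d\<close> is orthogonal to the simple roots of
    \<open>A\<close> by \<open>orth\<close>, and so is \<open>d\<close> itself; hence
    \<open>e\<close> is too, and it must vanish.\<close>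
  define A where "A = {i. co m i > 0 \<and> co d i > 0}"
  define e where "e = (\<Sum>j\<in>A. co d j *\<^sub>R \<alpha> j)"
  have "A = {}"
  proof (rule ccontr)
    assume "A \<noteq> {}"
    then obtain a where a: "a \<in> A" by blast
    have "co d a = 0"
    proof (rule combination_eq_0[OF e_def _ a])
      fix i assume "i \<in> A"
      then have i: "co m i > 0" "i \<in> J" using in_J by (auto simp: A_def)
      have "0 = d \<bullet> \<alpha> i" using maximal_inner(2)[OF d m ne[symmetric] i(2,1)] by simp
      also have "d \<bullet> \<alpha> i = (\<Sum>j\<in>J. co d j * (\<alpha> j \<bullet> \<alpha> i))"
        by (subst RJ_expand[OF dC]) (simp add: inner_sum_left)
      also have "\<dots> = (\<Sum>j\<in>A. co d j * (\<alpha> j \<bullet> \<alpha> i))"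
      proof (rule sum.mono_neutral_right)
        show "\<forall>j\<in>J - A. co d j * (\<alpha> j \<bullet> \<alpha> i) = 0"
        proof
          fix j assume "j \<in> J - A"
          then have j: "\<not> (co m j > 0 \<and> co d j > 0)" by (simp add: A_def)
          show "co d j * (\<alpha> j \<bullet> \<alpha> i) = 0"
          proof (cases "co d j > 0")
            case True
            then show ?thesis using orth[OF i(1) True] j by (simp add: inner_commute)
          next
            case False
            then have "co d j = 0" using d0[of j] by linarith
            then show ?thesis by simp
          qed
        qed
      qed (auto simp: A_def in_J)
      finally show "e \<bullet> \<alpha> i = 0" by (simp add: e_def inner_sum_left)
    qed
    with a show False by (simp add: A_def)
  qed
  with i j show ?thesis by (intro orth) (auto simp: A_def)
qed

text \<open>Take the part of \<open>c\<close> along simple roots outside \<open>C\<close>. Those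
  simple roots are orthogonal to \<open>c\<close> and to the simple roots inside \<open>C\<close>,
  hence to this part, which is therefore 0.\<close>

lemma support_in_C: assumes c: "c \<in> C" and j: "j \<in> J" "\<alpha> j \<notin> C" shows "co c j = 0"
proof -
  define A where "A = {j \<in> J. \<alpha> j \<notin> C}"
  define e where "e = (\<Sum>j\<in>A. co c j *\<^sub>R \<alpha> j)"
  have cJ: "c \<in> RJ J" using c C_sub by blast
  show ?thesis
  proof (rule combination_eq_0[OF e_def])
    fix i assume i: "i \<in> A"
    then have iJ: "\<alpha> i \<in> RJ J" "\<alpha> i \<notin> C" by (auto simp: A_def simple_RJ)
    have "0 = c \<bullet> \<alpha> i" using C_closed[OF c iJ(1)] iJ(2) by auto
    also have "\<dots> = (\<Sum>j\<in>J. co c j * (\<alpha> j \<bullet> \<alpha> i))"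
      by (subst RJ_expand[OF cJ]) (simp add: inner_sum_left)
    also have "\<dots> = (\<Sum>j\<in>A. co c j * (\<alpha> j \<bullet> \<alpha> i))"
    proof (rule sum.mono_neutral_right)
      show "\<forall>j\<in>J - A. co c j * (\<alpha> j \<bullet> \<alpha> i) = 0"
        using C_closed[OF _ iJ(1)] iJ(2) by (auto simp: A_def)
    qed (auto simp: A_def)
    finally show "e \<bullet> \<alpha> i = 0" by (simp add: e_def inner_sum_left)
  qed (use j in \<open>simp add: A_def\<close>)
qed

lemma orthogonal_of_supports:
  assumes "c \<in> C" "d \<in> C" "\<And>i j. co c i \<noteq> 0 \<Longrightarrow> co d j \<noteq> 0 \<Longrightarrow> \<alpha> i \<bullet> \<alpha> j = 0"
  shows "c \<bullet> d = 0"
proof -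
  have "c \<bullet> d = (\<Sum>i\<in>UNIV. \<Sum>j\<in>UNIV. co c i * co d j * (\<alpha> i \<bullet> \<alpha> j))"
    by (subst root_expand(1)[OF C_R[OF assms(1)]], subst root_expand(1)[OF C_R[OF assms(2)]])
       (simp add: inner_sum_left inner_sum_right sum_distrib_left algebra_simps, rule sum.swap)
  also have "\<dots> = 0"
    using assms(3) by (intro sum.neutral ballI) (metis mult_eq_0_iff)
  finally show ?thesis .
qed

end

definition component_of :: "'n set \<Rightarrow> complex^'n \<Rightarrow> (complex^'n) set" where
  "component_of J g = {c \<in> RJ J. (g, c) \<in> {(x, y). x \<in> RJ J \<and> y \<in> RJ J \<and> bf x y \<noteq> 0}\<^sup>*}"

text \<open>Every root of the component lies below a maximal one. Along a chain of consecutively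
  non-orthogonal roots the maximal root cannot change, since different maximal roots have orthogonal
  supports; so a single one dominates the component. The conclusions are the premises under which
  the condition on \<open>h\<close> is assumed, together with a bound at \<open>g\<close>.\<close>

lemma highest_root_component:
  assumes g: "g \<in> RJ J"
  defines "C \<equiv> component_of J g"
  obtains \<theta> m where "is_component (RJ J) C" "\<theta> \<in> C" "\<theta> \<in> Pos"
    "\<forall>c\<in>C. nncomb \<alpha> {j \<in> J. \<alpha> j \<in> C} (\<theta> - c)"
    "\<theta> = (\<Sum>j\<in>{j \<in> J. \<alpha> j \<in> C}. of_nat (m j) *s \<alpha> j)"
    "\<forall>i. \<bar>co g i\<bar> \<le> co \<theta> i"
proof -
  have comp: "is_component (RJ J) C"
    using g unfolding is_component_def C_def component_of_def by blast
  have sub: "C \<subseteq> RJ J" by (auto simp: C_def component_of_def)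
  have closed: "d \<in> C" if "c \<in> C" "d \<in> RJ J" "c \<bullet> d \<noteq> 0" for c d
  proof -
    have "bf c d \<noteq> 0" using that sub by (auto simp: bf_root RJ_in)
    then have "(c, d) \<in> {(x, y). x \<in> RJ J \<and> y \<in> RJ J \<and> bf x y \<noteq> 0}" using that sub by auto
    then show ?thesis using that unfolding C_def component_of_def by (auto intro: rtrancl_into_rtrancl)
  qed
  have ctx: "union_of_components J C" using sub closed unfolding union_of_components_def by blast
  have CR: "c \<in> C \<Longrightarrow> c \<in> R" for c by (rule C_R[OF ctx])
  have gC: "g \<in> C" using g by (simp add: C_def component_of_def)
  have above: "\<exists>m. maximal_in C m \<and> (\<forall>i. \<bar>co c i\<bar> \<le> co m i)" if c: "c \<in> C" for c
  proof -
    \<comment> \<open>One of c and -c is positive and both lie in \<open>C\<close>; the absolute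
      value covers both at once.\<close>
    obtain c' where c': "c' \<in> C" "c' \<in> Pos" "\<And>i. co c' i = \<bar>co c i\<bar>"
    proof (cases "c \<in> Pos")
      case True
      then show ?thesis using that[of c] c by (simp add: pos_co)
    next
      case False
      then have neg: "- c \<in> Pos" using pos_or_neg[OF CR[OF c]] by blast
      have "co (- c) i = \<bar>co c i\<bar>" for i using pos_co[OF neg, of i] by (simp add: co_minus)
      then show ?thesis using that[of "- c"] C_neg[OF ctx c] neg by simp
    qed
    have "C \<subseteq> R" using CR by blast
    then obtain m where "m \<in> C" "le_co c' m" "\<forall>d\<in>C. le_co m d \<longrightarrow> d = m"
      using ex_maximal_above[of C c'] c'(1) by blast
    then show ?thesis using c'(3) by (auto simp: maximal_in_def le_co_def)
  qed
  obtain \<theta> where th: "maximal_in C \<theta>" "\<And>i. \<bar>co g i\<bar> \<le> co \<theta> i" using above[OF gC] by blast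
  have bound: "\<bar>co c i\<bar> \<le> co \<theta> i" if "c \<in> C" for c i
  proof -
    have "(g, c) \<in> {(x, y). x \<in> RJ J \<and> y \<in> RJ J \<and> bf x y \<noteq> 0}\<^sup>*"
      using that by (simp add: C_def component_of_def)
    then have "c \<in> C \<and> (\<forall>i. \<bar>co c i\<bar> \<le> co \<theta> i)"
    proof (induction rule: rtrancl_induct)
      case base
      then show ?case using gC th by blast
    next
      case (step c d)
      then have cd: "c \<in> C" "d \<in> RJ J" "c \<bullet> d \<noteq> 0" "\<And>i. \<bar>co c i\<bar> \<le> co \<theta> i"
        by (auto simp: bf_root RJ_in)
      then have dC: "d \<in> C" by (intro closed[of c d])
      obtain d' where d': "maximal_in C d'" "\<And>i. \<bar>co d i\<bar> \<le> co d' i" using above[OF dC] by blast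
      have "d' = \<theta>"
      proof (rule ccontr)
        assume "d' \<noteq> \<theta>"
        have "c \<bullet> d = 0"
        proof (rule orthogonal_of_supports[OF ctx cd(1) dC])
          fix i j assume "co c i \<noteq> 0" "co d j \<noteq> 0"
          then have "co \<theta> i > 0" "co d' j > 0" using cd(4)[of i] d'(2)[of j] by linarith+
          then show "\<alpha> i \<bullet> \<alpha> j = 0"
            by (rule maximal_supports_orthogonal[OF ctx th(1) d'(1) \<open>d' \<noteq> \<theta>\<close>[symmetric]])
        qed
        with cd(3) show False by simp
      qed
      with d'(2) dC show ?case by simp
    qed
    then show ?thesis by blast
  qed
  have thC: "\<theta> \<in> C" using th by (simp add: maximal_in_def)
  define K where "K = {j \<in> J. \<alpha> j \<in> C}"
  have offK: "co c i = 0" if "c \<in> C" "i \<notin> K" for c i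
    using that support_in_C[OF ctx that(1)] RJ_co[of c J i] sub by (auto simp: K_def)
  have nn: "nncomb \<alpha> K (\<theta> - c)" if "c \<in> C" for c
  proof (rule nncombI)
    have "\<theta> - c = (\<Sum>i\<in>UNIV. co \<theta> i *\<^sub>R \<alpha> i) - (\<Sum>i\<in>UNIV. co c i *\<^sub>R \<alpha> i)"
      using root_expand(1)[OF CR[OF thC]] root_expand(1)[OF CR[OF that]] by simp
    then show "\<theta> - c = (\<Sum>i\<in>UNIV. co (\<theta> - c) i *\<^sub>R \<alpha> i)"
      unfolding co_diff scaleR_diff_left sum_subtractf .
    show "co (\<theta> - c) i \<in> \<int>" for i using co_Ints CR thC that by (simp add: co_diff)
    show "co (\<theta> - c) i \<ge> 0" for i using bound[OF that, of i] by (simp add: co_diff)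
    show "co (\<theta> - c) i = 0" if "i \<notin> K" for i using offK[OF thC that] offK[OF \<open>c \<in> C\<close> that] by (simp add: co_diff)
  qed
  have pos: "\<theta> \<in> Pos" by (rule maximal_pos[OF ctx th(1)])
  have "nncomb \<alpha> K \<theta>"
    by (rule nncombI) (use root_expand(1)[OF CR[OF thC]] co_Ints[OF CR[OF thC]] pos_co[OF pos] offK[OF thC] in auto)
  then obtain m where "\<theta> = (\<Sum>j\<in>K. of_nat (m j) *s \<alpha> j)" unfolding nncomb_def by blast
  then show ?thesis using that[of \<theta> m] comp thC pos nn bound[OF gC] by (simp add: K_def)
qed

end

section \<open>Shifts of the subspace arrangement\<close>

lemma aff_cor_0: "aff_cor (a, 0) = (cor a, 0)"
  by (simp add: aff_cor_def cor_def)

lemma aev_aff_cor: "aev (aff_cor (a, z)) x = 2 / bf a a * (bf a x + z)"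
  by (simp add: aev_def aff_cor_def bf_simps distrib_left)

context based_root_system
begin

lemma RJ_pos_image:
  assumes s: "s \<in> weyl R" and pos: "\<And>j. j \<in> J \<Longrightarrow> s (\<alpha> j) \<in> Pos" and g: "g \<in> RJ J" "g \<in> Pos"
  shows "s g \<in> Pos"
proof -
  have "s g = (\<Sum>j\<in>J. co g j *\<^sub>R s (\<alpha> j))"
    using arg_cong[OF RJ_expand[OF g(1)], of s] by (simp add: weyl_sum weyl_scaleR s)
  then have "co (s g) i = (\<Sum>j\<in>J. co g j * co (s (\<alpha> j)) i)" for i
    by (simp add: co_simps)
  also have "\<dots> i \<ge> 0" for i
    by (intro sum_nonneg mult_nonneg_nonneg pos_co pos g)
  finally show ?thesis using weyl_root[OF s RJ_in[OF g(1)]] by (simp add: pos_iff)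
qed

text \<open>Induction on the number of positive roots of \<open>RJ J\<close> made negative by
  \<open>w\<close>; composing with a simple reflection at which \<open>w\<close> fails lowers it.
  That \<open>v\<close> and its inverse \<open>v'\<close> preserve \<open>RJ J\<close> is what is
  kept of the membership of \<open>v\<close> in the parabolic subgroup of \<open>J\<close>.\<close>

lemma minimal_coset_representative:
  "w \<in> weyl R \<Longrightarrow> \<exists>v\<in>weyl R. \<exists>v'\<in>weyl R. (\<forall>x. v' (v x) = x) \<and> (\<forall>x. v (v' x) = x) \<and>
     (\<forall>g\<in>RJ J. v g \<in> RJ J \<and> v' g \<in> RJ J) \<and> (\<forall>j\<in>J. w (v (\<alpha> j)) \<in> Pos)"
proof (induction "card {g \<in> RJ J \<inter> Pos. w g \<notin> Pos}" arbitrary: w rule: less_induct)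
  case less
  show ?case
  proof (cases "\<forall>j\<in>J. w (\<alpha> j) \<in> Pos")
    case True
    then show ?thesis by (intro bexI[of _ id]) (auto intro: weyl_id)
  next
    case False
    then obtain j where j: "j \<in> J" "w (\<alpha> j) \<notin> Pos" by blast
    define s where "s = refl (\<alpha> j)"
    have s: "s \<in> weyl R" "s (s x) = x" "s (\<alpha> j) = - \<alpha> j" for x
      by (simp_all add: s_def refl_weyl simple_in refl_refl refl_self bf_root_nz)
    have sRJ: "g \<in> RJ J \<Longrightarrow> s g \<in> RJ J" for g
      unfolding s_def by (rule refl_RJ) (rule simple_RJ[OF j(1)])
    let ?N = "\<lambda>w. {g \<in> RJ J \<inter> Pos. w g \<notin> Pos}"
    have fin: "finite (?N w)" for w
      by (rule finite_subset[OF _ finite_R]) (auto simp: RJ_in)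
    have "- w (\<alpha> j) \<in> Pos"
      using j pos_or_neg[OF weyl_root[OF less.prems simple_in]] by blast
    then have aj: "\<alpha> j \<notin> ?N (w \<circ> s)" by (simp add: s weyl_minus[OF less.prems])
    \<comment> \<open>The simple reflection permutes the positive roots other than
      \<open>\<alpha> j\<close>, so it carries the inversions of the new element injectively to
      those of \<open>w\<close>, and misses \<open>\<alpha> j\<close>.\<close>
    have "s ` ?N (w \<circ> s) \<subseteq> ?N w - {\<alpha> j}"
    proof
      fix y assume "y \<in> s ` ?N (w \<circ> s)"
      then obtain g where g: "y = s g" "g \<in> RJ J" "g \<in> Pos" "w (s g) \<notin> Pos" by auto
      then have "g \<noteq> \<alpha> j" using aj by auto
      then have sg: "s g \<in> Pos" unfolding s_def by (intro refl_simple_pos g)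
      moreover have "s g \<noteq> \<alpha> j"
      proof
        assume "s g = \<alpha> j"
        then have "g = - \<alpha> j" using s(2)[of g] s(3) by simp
        with g(3) not_pos_and_neg[OF simple_pos] show False by simp
      qed
      ultimately show "y \<in> ?N w - {\<alpha> j}" using g sRJ by auto
    qed
    moreover have "\<alpha> j \<in> ?N w" using j simple_RJ simple_pos by auto
    moreover have "inj_on s (?N (w \<circ> s))" by (rule inj_onI) (metis s(2))
    ultimately have "card (?N (w \<circ> s)) < card (?N w)"
      by (metis (no_types, lifting) card_image card_mono card_Diff1_less fin finite_Diff le_less_trans)
    then have "\<exists>v\<in>weyl R. \<exists>v'\<in>weyl R. (\<forall>x. v' (v x) = x) \<and> (\<forall>x. v (v' x) = x) \<and>
       (\<forall>g\<in>RJ J. v g \<in> RJ J \<and> v' g \<in> RJ J) \<and> (\<forall>j\<in>J. (w \<circ> s) (v (\<alpha> j)) \<in> Pos)"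
      by (rule less.hyps[OF _ weyl_compose[OF less.prems s(1)]])
    then obtain v v' where v: "v \<in> weyl R" "v' \<in> weyl R" "(\<forall>x. v' (v x) = x) \<and> (\<forall>x. v (v' x) = x) \<and>
       (\<forall>g\<in>RJ J. v g \<in> RJ J \<and> v' g \<in> RJ J) \<and> (\<forall>j\<in>J. (w \<circ> s) (v (\<alpha> j)) \<in> Pos)"
      by (elim bexE) (rule that)
    show ?thesis
      by (rule bexI[of _ "s \<circ> v"], rule bexI[of _ "v' \<circ> s"])
         (use v s(2) sRJ in \<open>auto intro: weyl_compose s(1)\<close>)
  qed
qed

section \<open>Invariant functions on affine coroots\<close>

lemma aff_coroots_0: "a \<in> R \<Longrightarrow> aff_cor (a, 0) \<in> aff_coroots R h"
proof -
  assume "a \<in> R"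
  moreover have "aff_cor (a, 0) = aff_cor (a, h * of_int 0)" by simp
  ultimately show ?thesis unfolding aff_coroots_def by blast
qed

lemma invariant_weyl:
  assumes t: "hatW_invariant R h t" and w: "w \<in> weyl R" and a: "a \<in> R"
  shows "t (aff_cor (w a, 0)) = t (aff_cor (a, 0))"
proof -
  have "waff h w 0 (aff_cor (a, 0)) = aff_cor (w a, 0)"
    by (simp add: waff_def aff_cor_0 weyl_cor w bf_simps)
  moreover have "0 \<in> coweights R" by (simp add: coweights_def bf_simps)
  ultimately show ?thesis using t w aff_coroots_0[OF a] unfolding hatW_invariant_def by metis
qed

lemma invariant_minus:
  assumes "hatW_invariant R h t" "a \<in> R"
  shows "t (aff_cor (- a, 0)) = t (aff_cor (a, 0))"
  using invariant_weyl[OF assms(1) refl_weyl[OF assms(2)] assms(2)]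
  by (simp add: refl_self bf_root_nz assms(2))

lemma bf_b: "a \<in> R \<Longrightarrow> bf a (b i) = of_real (co a i)"
proof -
  assume a: "a \<in> R"
  have "bf a (b i) = (\<Sum>j\<in>UNIV. of_real (co a j) * bf (\<alpha> j) (b i))"
    using arg_cong[OF root_expand(1)[OF a], of "\<lambda>x. bf x (b i)"]
    by (simp add: bf_sum_left scaleR_eq_vector_scalar_mult bf_simps)
  then show ?thesis by (simp add: dual if_distrib cong: if_cong)
qed

lemma b_coweight: "b i \<in> coweights R"
  using co_Ints by (auto simp: coweights_def bf_b)

text \<open>Some simple root has positive product with \<open>a\<close>, as otherwise
  \<open>a \<bullet> a\<close> would be nonpositive. Reflecting in it lowers the height and keeps
  the root positive, unless \<open>a\<close> is that simple root.\<close>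

lemma pos_root_conjugate_simple:
  "a \<in> Pos \<Longrightarrow> \<exists>v\<in>weyl R. \<exists>j. v a = \<alpha> j"
proof (induction "nat \<lfloor>ht a\<rfloor>" arbitrary: a rule: less_induct)
  case less
  have aR: "a \<in> R" by (rule pos_in[OF less.prems])
  have ht_Ints: "ht c \<in> \<int>" if "c \<in> R" for c
    unfolding ht_def by (intro Ints_sum co_Ints that)
  have "\<exists>j. a \<bullet> \<alpha> j > 0"
  proof (rule ccontr)
    assume "\<not> ?thesis"
    then have "co a j * (a \<bullet> \<alpha> j) \<le> 0" for j
      using pos_co[OF less.prems, of j] by (simp add: mult_nonneg_nonpos not_less)
    then have "(\<Sum>j\<in>UNIV. co a j * (a \<bullet> \<alpha> j)) \<le> 0" by (intro sum_nonpos)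
    moreover have "a \<bullet> a = (\<Sum>j\<in>UNIV. co a j * (a \<bullet> \<alpha> j))"
      by (subst (2) root_expand(1)[OF aR]) (simp add: inner_sum_right)
    ultimately show False using root_inner_pos[OF aR] by simp
  qed
  then obtain j where j: "a \<bullet> \<alpha> j > 0" by blast
  show ?case
  proof (cases "a = \<alpha> j")
    case True
    then show ?thesis by (intro bexI[of _ id]) (auto intro: weyl_id)
  next
    case False
    then have pos: "refl (\<alpha> j) a \<in> Pos" by (rule refl_simple_pos[OF less.prems])
    have "ht (refl (\<alpha> j) a) < ht a"
      using j root_inner_pos[OF simple_in[of j]]
      by (simp add: refl_eq_inner simple_in aR ht_diff ht_scaleR ht_simple inner_commute)
    moreover obtain m n :: int where "ht (refl (\<alpha> j) a) = of_int m" "ht a = of_int n"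
      using ht_Ints[OF aR] ht_Ints[OF pos_in[OF pos]] by (auto elim!: Ints_cases)
    moreover have "ht (refl (\<alpha> j) a) \<ge> 1" by (rule ht_ge_1[OF pos])
    ultimately have "nat \<lfloor>ht (refl (\<alpha> j) a)\<rfloor> < nat \<lfloor>ht a\<rfloor>" by simp
    from less.hyps[OF this pos] obtain v i where "v \<in> weyl R" "v (refl (\<alpha> j) a) = \<alpha> i" by blast
    then show ?thesis
      by (intro bexI[of _ "v \<circ> refl (\<alpha> j)"]) (auto intro!: weyl_compose refl_weyl simple_in)
  qed
qed

lemma invariant_affine_node:
  assumes t: "hatW_invariant R h t" and a: "a \<in> Pos"
  shows "t (aff_cor (- a, h)) = t (aff_cor (a, 0))"
proof -
  have aR: "a \<in> R" by (rule pos_in[OF a])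
  obtain v j where v: "v \<in> weyl R" "v a = \<alpha> j" using pos_root_conjugate_simple[OF a] by blast
  obtain v' where v': "v' \<in> weyl R" "\<And>x. v' (v x) = x" "\<And>x. v (v' x) = x" using weyl_inverse[OF v(1)] by blast
  \<comment> \<open>A coweight with (a, l) = -1 is needed, so that translation cancels the constant
    term h. The coroot of \<open>a\<close> pairs to 2 with it; a fundamental coweight pulled back
    along the conjugation to a simple root pairs to 1.\<close>
  define l where "l = - v' (b j)"
  have "bf c (v' (b j)) = bf (v c) (b j)" for c
    using weyl_bf[OF v(1), of c "v' (b j)"] by (simp add: v')
  then have l: "bf c l = - bf (v c) (b j)" for c by (simp add: l_def bf_simps)
  have lw: "l \<in> coweights R"
    using b_coweight[of j] weyl_root[OF v(1)] by (simp add: coweights_def l)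
  have al: "bf a l = -1" by (simp add: l v dual)
  have r: "refl a (- (c *s a)) = c *s a" for c
    using refl_scale[of a "- c" a]
    by (simp add: refl_self bf_root_nz aR vector_scalar_mult_linear_left vector_scalar_mult_linear_right)
  have "waff h (refl a) l (aff_cor (- a, h)) = aff_cor (a, 0)"
    using bf_root_nz[OF aR] r
    by (simp add: waff_def aff_cor_def bf_simps al vector_scalar_mult_linear_right)
  moreover have "aff_cor (- a, h) = aff_cor (- a, h * of_int 1)" by simp
  then have "aff_cor (- a, h) \<in> aff_coroots R h"
    unfolding aff_coroots_def using neg_in[OF aR] by blast
  ultimately show ?thesis using t refl_weyl[OF aR] lw unfolding hatW_invariant_def by metis
qed

section \<open>Values on the arrangement and shifts of its points\<close>

definition highest_cond :: "complex \<Rightarrow> ((complex^'n) \<times> complex \<Rightarrow> complex) \<Rightarrow> 'n set \<Rightarrow> bool" where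
  "highest_cond h \<eta> J \<longleftrightarrow> (\<forall>C thC m. is_component (RJ J) C \<and> thC \<in> C
      \<and> (\<forall>c\<in>C. nncomb \<alpha> {j\<in>J. \<alpha> j \<in> C} (thC - c))
      \<and> thC = (\<Sum>j\<in>{j\<in>J. \<alpha> j \<in> C}. of_nat (m j) *s \<alpha> j)
      \<longrightarrow> hcheck \<alpha> {j\<in>J. \<alpha> j \<in> C} \<eta> thC m = h)"

text \<open>On \<open>D0\<close> the sum in \<open>hcheck\<close> is the value of the highest root
  at x. The condition thus says that h minus this root takes the value dictated by
  \<open>\<eta>\<close>, just as the simple roots do.\<close>

lemma highest_root_value:
  assumes hc: "highest_cond h \<eta> J" and g: "g \<in> RJ J" and x: "x \<in> D0 \<alpha> J \<eta>"
  shows "\<exists>\<theta>\<in>RJ J \<inter> Pos. (\<forall>i. co g i \<le> co \<theta> i) \<and> bf \<theta> x = h - bf \<theta> \<theta> / 2 * \<eta> (aff_cor (\<theta>, 0))"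
proof -
  obtain \<theta> m where th: "is_component (RJ J) (component_of J g)" "\<theta> \<in> component_of J g" "\<theta> \<in> Pos"
    "\<forall>c\<in>component_of J g. nncomb \<alpha> {j \<in> J. \<alpha> j \<in> component_of J g} (\<theta> - c)"
    "\<theta> = (\<Sum>j\<in>{j \<in> J. \<alpha> j \<in> component_of J g}. of_nat (m j) *s \<alpha> j)"
    "\<forall>i. \<bar>co g i\<bar> \<le> co \<theta> i"
    by (rule highest_root_component[OF g])
  let ?K = "{j \<in> J. \<alpha> j \<in> component_of J g}"
  have "hcheck \<alpha> ?K \<eta> \<theta> m = h" using hc th unfolding highest_cond_def by blast
  moreover have aj: "bf (\<alpha> j) x = bf (\<alpha> j) (\<alpha> j) / 2 * \<eta> (aff_cor (\<alpha> j, 0))" if "j \<in> ?K" for j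
    using x that bf_root_nz[OF simple_in[of j]] by (auto simp: D0_def bf_cor field_simps)
  have "bf \<theta> x = (\<Sum>j\<in>?K. bf (\<alpha> j) (\<alpha> j) / 2 * of_nat (m j) * \<eta> (aff_cor (\<alpha> j, 0)))"
    by (subst th(5), unfold bf_sum_left bf_scale_left, rule sum.cong[OF refl], subst aj) simp_all
  ultimately have "bf \<theta> x = h - bf \<theta> \<theta> / 2 * \<eta> (aff_cor (\<theta>, 0))"
    by (simp add: hcheck_def algebra_simps)
  moreover have "\<theta> \<in> RJ J" using th(2) by (simp add: component_of_def)
  moreover have "co g i \<le> co \<theta> i" for i using th(6) abs_ge_self order_trans by blast
  ultimately show ?thesis using th(3) by blast
qed

lemma Wplus_pos: "w \<in> Wplus R \<alpha> J \<Longrightarrow> g \<in> RJ J \<Longrightarrow> g \<in> Pos \<Longrightarrow> w g \<in> Pos"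
  by (rule RJ_pos_image[where J = J]) (auto simp: Wplus_def)

text \<open>The affine simple roots of the components of \<open>R0\<close> take prescribed values on \<open>D0\<close>, the affine ones
  because of the condition on \<open>h\<close>. A lattice shift permutes them up to the choice of a new simple system,
  consisting of simple roots of level 0 and negatives of highest roots of level 1.\<close>
lemma shift_into_Dset:
  assumes hc: "highest_cond h \<eta> J" and eta: "hatW_invariant R h \<eta>"
    and w: "w \<in> Wplus R \<alpha> J" and x: "x \<in> D0 \<alpha> J \<eta>" and s: "s \<in> weyl R"
    and lev: "\<And>g. g \<in> RJ J \<Longrightarrow> g \<in> Pos \<Longrightarrow>
       (bf (w g) l = 0 \<and> s (w g) \<in> Pos) \<or> (bf (w g) l = 1 \<and> - s (w g) \<in> Pos)"
  shows "s (w x - h *s l) \<in> Dset R \<alpha> J \<eta>"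
proof -
  have wW: "w \<in> weyl R" using w by (simp add: Wplus_def)
  obtain w' where w': "w' \<in> weyl R" "\<And>x. w' (w x) = x" "\<And>x. w (w' x) = x" using weyl_inverse[OF wW] by blast
  define sw where "sw = s \<circ> w"
  have sw: "sw \<in> weyl R" unfolding sw_def by (rule weyl_compose[OF s wW])
  \<comment> \<open>\<open>sw\<close> need not send the simple roots of \<open>J\<close> to positive
    roots; \<open>v\<close> repairs this inside \<open>RJ J\<close>. The shifted point is the image
    of \<open>v' z\<close> under \<open>sw \<circ> v\<close>, with \<open>z\<close> defined below,
    so the task is to show that the roots \<open>v (\<alpha> j)\<close> take their
    \<open>\<eta>\<close> values at \<open>z\<close>.\<close>
  obtain v v' where v0: "v \<in> weyl R" "v' \<in> weyl R" "(\<forall>x. v' (v x) = x) \<and> (\<forall>x. v (v' x) = x) \<and>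
     (\<forall>g\<in>RJ J. v g \<in> RJ J \<and> v' g \<in> RJ J) \<and> (\<forall>j\<in>J. sw (v (\<alpha> j)) \<in> Pos)"
    using minimal_coset_representative[OF sw, of J] by (elim bexE) (rule that)
  note v1 = v0(3)[THEN conjunct2, THEN conjunct2]
  note v = v0(1,2) v0(3)[THEN conjunct1, THEN spec] v0(3)[THEN conjunct2, THEN conjunct1, THEN spec]
    v1[THEN conjunct1, THEN bspec, THEN conjunct1] v1[THEN conjunct1, THEN bspec, THEN conjunct2]
    v1[THEN conjunct2, THEN bspec]
  have swv: "sw \<circ> v \<in> weyl R" by (rule weyl_compose[OF sw v(1)])
  have pos_v': "v' g \<in> Pos" if "g \<in> RJ J" "sw g \<in> Pos" for g
  proof (rule ccontr)
    assume "v' g \<notin> Pos"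
    then have neg: "- v' g \<in> Pos" using pos_or_neg[OF weyl_root[OF v(2) RJ_in[OF that(1)]]] by blast
    have "(sw \<circ> v) (- v' g) \<in> Pos"
      by (rule RJ_pos_image[OF swv _ neg_RJ[OF v(6)[OF that(1)]] neg]) (simp add: v(7))
    then have "- sw g \<in> Pos" by (simp add: weyl_minus v sw)
    with not_pos_and_neg that(2) show False by blast
  qed
  \<comment> \<open>The level: after the shift, the root \<open>g\<close> acquires linear part
    \<open>sw g\<close> and constant term \<open>h\<close> times \<open>k g\<close>.\<close>
  define k where "k = (\<lambda>g. Re (bf (w g) l))"
  have k_add: "k (x + y) = k x + k y" and k_minus: "k (- x) = - k x" and k_scaleR: "k (r *\<^sub>R x) = r * k x" for x y r
    by (simp_all add: k_def weyl_add[OF wW] weyl_minus[OF wW] weyl_scale[OF wW] bf_simps scaleR_eq_vector_scalar_mult)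
  have k_sum: "k (sum f A) = (\<Sum>i\<in>A. k (f i))" for f and A :: "'n set"
    by (simp add: k_def weyl_sum[OF wW] bf_sum_left)
  have k_cases: "k g = 0 \<and> bf (w g) l = 0 \<and> sw g \<in> Pos \<or> k g = 1 \<and> bf (w g) l = 1 \<and> sw (- g) \<in> Pos"
    if "g \<in> RJ J" "g \<in> Pos" for g
    using lev[OF that] by (auto simp: k_def sw_def weyl_minus[OF wW] weyl_minus[OF s])
  have level_0: "v' (\<alpha> i) \<in> Pos" if "i \<in> J" "k (\<alpha> i) = 0" for i
    using k_cases[OF simple_RJ[OF that(1)] simple_pos] that by (auto intro!: pos_v' simple_RJ)
  have k_nonneg: "k (\<alpha> i) \<ge> 0" if "i \<in> J" for i
    using k_cases[OF simple_RJ[OF that(1)] simple_pos] by auto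
  \<comment> \<open>Levels of simple roots are nonnegative, so a nonnegative combination of level at
    most 0 involves only those of level 0.\<close>
  have sum_0: "k (\<alpha> i) = 0" if "(\<Sum>j\<in>J. d j * k (\<alpha> j)) \<le> 0" "\<And>j. d j \<ge> 0" "i \<in> J" "d i > 0" for d i
  proof -
    have nn: "d j * k (\<alpha> j) \<ge> 0" if "j \<in> J" for j using k_nonneg that \<open>\<And>j. d j \<ge> 0\<close> by simp
    then have "(\<Sum>j\<in>J. d j * k (\<alpha> j)) = 0" using that(1) by (intro antisym sum_nonneg)
    then have "\<forall>j\<in>J. d j * k (\<alpha> j) = 0" using nn by (subst sum_nonneg_eq_0_iff[symmetric]) auto
    with that(3,4) show ?thesis by force
  qed
  define z where "z = x - h *s w' l"
  have bfz: "bf g z = bf g x - h * bf (w g) l" for g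
    using weyl_bf[OF wW, of g "w' l"] by (simp add: z_def bf_simps w')
  have val: "bf (cor (v (\<alpha> j))) z = \<eta> (aff_cor (v (\<alpha> j), 0))" if j: "j \<in> J" for j
  proof -
    define g where "g = v (\<alpha> j)"
    have gJ: "g \<in> RJ J" unfolding g_def by (rule v(5)[OF simple_RJ[OF j]])
    have gR: "g \<in> R" by (rule RJ_in[OF gJ])
    have sg: "sw g \<in> Pos" unfolding g_def by (rule v(7)[OF j])
    have v'g: "v' g = \<alpha> j" by (simp add: g_def v)
    have "bf (cor g) z = \<eta> (aff_cor (g, 0))"
    proof (cases "g \<in> Pos")
      \<comment> \<open>A positive \<open>g\<close> with \<open>sw g\<close> positive has level 0,
        hence so have all its simple constituents. Their images under \<open>v'\<close> are
        positive, and as \<open>v' g\<close> is simple, \<open>g\<close> is itself simple.\<close>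
      case True
      then have kg: "k g = 0" "bf (w g) l = 0"
        using k_cases[OF gJ True] sg not_pos_and_neg[OF sg] by (auto simp: weyl_minus sw)
      have "k g = (\<Sum>i\<in>J. co g i * k (\<alpha> i))"
        using arg_cong[OF RJ_expand[OF gJ], of k] by (simp add: k_sum k_scaleR)
      then have k0: "k (\<alpha> i) = 0" if "co g i > 0" for i
        using sum_0[of "co g" i] that kg RJ_co[OF gJ, of i] pos_co[OF True] by fastforce
      have "\<exists>i. g = \<alpha> i"
      proof (rule simple_image[OF v(2) True _ v'g])
        fix i assume "co g i > 0"
        then show "v' (\<alpha> i) \<in> Pos" using RJ_co[OF gJ, of i] by (intro level_0 k0) force
      qed
      then obtain i where i: "g = \<alpha> i" by blast
      then have "i \<in> J" using RJ_co[OF gJ, of i] by (auto simp: co_simple)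
      then have "bf (cor g) x = \<eta> (aff_cor (g, 0))" using x i by (simp add: D0_def)
      then show ?thesis by (simp add: bf_cor bfz[of g] kg)
    next
      case False
      then have ng: "- g \<in> Pos" using pos_or_neg[OF gR] by blast
      have kg: "k (- g) = 1"
        using k_cases[OF neg_RJ[OF gJ] ng] not_pos_and_neg[OF sg] by (auto simp: weyl_minus sw)
      obtain \<theta> where th: "\<theta> \<in> RJ J" "\<theta> \<in> Pos" "\<And>i. co (- g) i \<le> co \<theta> i"
        "bf \<theta> x = h - bf \<theta> \<theta> / 2 * \<eta> (aff_cor (\<theta>, 0))"
        using highest_root_value[OF hc neg_RJ[OF gJ] x] by blast
      \<comment> \<open>Coordinates of \<theta> - (-g), nonnegative because \<theta> dominates -g.
        Since -g already has level 1 and \<theta> has level at most 1, the simple roots occurring in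
        \<open>d\<close> have level 0.\<close>
      define d where "d = (\<lambda>i. co \<theta> i + co g i)"
      have d0: "d i \<ge> 0" for i using th(3)[of i] by (simp add: d_def co_minus)
      have sum: "\<theta> + g = (\<Sum>i\<in>J. d i *\<^sub>R \<alpha> i)"
        using RJ_expand[OF th(1)] RJ_expand[OF gJ] unfolding d_def scaleR_add_left sum.distrib by argo
      have "k \<theta> = 1 + (\<Sum>i\<in>J. d i * k (\<alpha> i))"
        using arg_cong[OF sum, of k] kg by (simp add: k_add k_sum k_scaleR k_minus)
      moreover have "(\<Sum>i\<in>J. d i * k (\<alpha> i)) \<ge> 0"
        by (intro sum_nonneg mult_nonneg_nonneg d0 k_nonneg)
      ultimately have k\<theta>: "bf (w \<theta>) l = 1" "sw (- \<theta>) \<in> Pos" and le0: "(\<Sum>i\<in>J. d i * k (\<alpha> i)) \<le> 0"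
        using k_cases[OF th(1,2)] by auto
      \<comment> \<open>The height of the simple root \<open>v' g\<close> is at least 1 plus the sum
        of the \<open>d i\<close>, because -\<theta> and the simple roots involved have positive
        images. So \<open>d\<close> is 0 and g = -\<theta>.\<close>
      have "1 = ht (v' g)" by (simp add: v'g ht_simple)
      also have "v' g = v' (- \<theta>) + (\<Sum>i\<in>J. d i *\<^sub>R v' (\<alpha> i))"
        using arg_cong[OF sum, of v'] by (simp add: weyl_add weyl_minus weyl_sum weyl_scaleR v(2) algebra_simps)
      also have "ht \<dots> = ht (v' (- \<theta>)) + (\<Sum>i\<in>J. d i * ht (v' (\<alpha> i)))"
        by (simp add: ht_add ht_sum ht_scaleR)
      also have "\<dots> \<ge> 1 + (\<Sum>i\<in>J. d i)"
      proof (intro add_mono sum_mono)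
        show "1 \<le> ht (v' (- \<theta>))" by (intro ht_ge_1 pos_v' neg_RJ th k\<theta>)
        fix i assume i: "i \<in> J"
        show "d i \<le> d i * ht (v' (\<alpha> i))"
        proof (cases "d i > 0")
          case True
          then show ?thesis using ht_ge_1[OF level_0[OF i sum_0[OF le0 d0 i True]]] by simp
        next
          case False
          then have "d i = 0" using d0[of i] by simp
          then show ?thesis by simp
        qed
      qed
      finally have "(\<Sum>i\<in>J. d i) \<le> 0" by simp
      then have "(\<Sum>i\<in>J. d i) = 0" using d0 by (intro antisym sum_nonneg)
      then have "\<forall>i\<in>J. d i = 0" using d0 by (subst sum_nonneg_eq_0_iff[symmetric]) auto
      then have "\<theta> + g = 0" using sum by simp
      then have g: "g = - \<theta>" by (simp add: eq_neg_iff_add_eq_0 add.commute)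
      \<comment> \<open>Level 1 of \<theta> adds \<open>h\<close> here, turning the value of
        -\<theta> at x into that of the affine simple root h - \<theta>.\<close>
      have gz: "bf g z = bf \<theta> \<theta> / 2 * \<eta> (aff_cor (\<theta>, 0))"
        unfolding bfz[of g] using th(4) k\<theta>(1) by (simp add: g weyl_minus[OF wW] bf_simps)
      have gg: "bf g g = bf \<theta> \<theta>" by (simp add: g bf_simps)
      show ?thesis
        unfolding bf_cor gz gg
        using bf_root_nz[OF RJ_in[OF th(1)]] invariant_minus[OF eta RJ_in[OF th(1)]] by (simp add: g)
    qed
    then show ?thesis by (simp add: g_def)
  qed
  have "v' z \<in> D0 \<alpha> J \<eta>"
    unfolding D0_def
  proof (intro CollectI ballI)
    fix j assume j: "j \<in> J"
    have "bf (cor (\<alpha> j)) (v' z) = bf (cor (v (\<alpha> j))) z"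
      using weyl_bf[OF v(1), of "cor (\<alpha> j)" "v' z"] by (simp add: v(4) weyl_cor v(1))
    also have "\<dots> = \<eta> (aff_cor (\<alpha> j, 0))"
      using val[OF j] invariant_weyl[OF eta v(1) simple_in] by simp
    finally show "bf (cor (\<alpha> j)) (v' z) = \<eta> (aff_cor (\<alpha> j, 0))" .
  qed
  moreover have "sw \<circ> v \<in> Wplus R \<alpha> J" using swv v(7) by (simp add: Wplus_def)
  moreover have "(sw \<circ> v) (v' z) = s (w x - h *s l)"
    by (simp add: v(4) sw_def z_def weyl_diff[OF wW] weyl_scale[OF wW] w')
  ultimately show ?thesis unfolding Dset_def by (metis UN_iff imageI)
qed

end

section \<open>Demazure--Lusztig operators on periodic functions\<close>

lemma vanish_by_continuity:
  fixes g :: "complex^'n \<Rightarrow> complex"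
  assumes g: "isCont g x" and v: "bf c v \<noteq> 0"
    and 0: "\<And>\<zeta>. exp (- (bf c (x + \<zeta> *s v) + d)) \<noteq> 1 \<Longrightarrow> g (x + \<zeta> *s v) = 0"
  shows "g x = 0"
proof (cases "exp (- (bf c x + d)) = 1")
  case False
  then show ?thesis using 0[of 0] by simp
next
  case True
  \<comment> \<open>With this step \<open>bf c\<close> moves by the real number 1/(n+1). The
    exponential of a nonzero real is never 1, so all these points leave the zero set.\<close>
  define z where "z = (\<lambda>n. of_real (inverse (real (Suc n))) / bf c v)"
  have "(\<lambda>n. of_real (inverse (real (Suc n)))) \<longlonglongrightarrow> (of_real 0 :: complex)"
    by (intro tendsto_of_real LIMSEQ_inverse_real_of_nat)
  then have "z \<longlonglongrightarrow> 0 / bf c v" unfolding z_def using v by (intro tendsto_divide) auto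
  then have "(\<lambda>n. x + z n *s v) \<longlonglongrightarrow> x + 0 *s v"
    by (intro tendsto_add tendsto_const bounded_linear.tendsto[OF bounded_linear_vector_scalar_mult_left]) simp
  then have "(\<lambda>n. x + z n *s v) \<longlonglongrightarrow> x" by simp
  then have "(\<lambda>n. g (x + z n *s v)) \<longlonglongrightarrow> g x" by (rule isCont_tendsto_compose[OF g])
  moreover have "g (x + z n *s v) = 0" for n
  proof (rule 0)
    have eq: "- (bf c (x + z n *s v) + d) = - (bf c x + d) + of_real (- inverse (real (Suc n)))"
      using v by (simp add: bf_simps z_def del: of_nat_Suc)
    have "exp (- inverse (real (Suc n))) \<noteq> 1" by (simp del: of_nat_Suc)
    then have "exp (of_real (- inverse (real (Suc n)))) \<noteq> (1::complex)"
      by (metis exp_of_real of_real_eq_1_iff)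
    then show "exp (- (bf c (x + z n *s v) + d)) \<noteq> 1" unfolding eq exp_add True by simp
  qed
  ultimately show ?thesis by (simp add: LIMSEQ_const_iff)
qed

lemma holo_isCont: "holo f \<Longrightarrow> isCont f x"
  using holo_on_continuous_on[of UNIV f] by (simp add: holo_iff continuous_on_eq_continuous_at)

lemma holo_shift: "holo f \<Longrightarrow> holo (\<lambda>x. f (x + p))"
  by (rule holo_compose_affine) auto

text \<open>Isolates the only singular term as a divided difference, whose numerator vanishes on the
  zeros of the denominator for periodic \<open>f\<close>.\<close>

lemma Tval_eq:
  assumes "exp (- aev (aff_cor a) x) \<noteq> 1"
  shows "Tval t a f x = t * f (arefl a x)
    + (inverse t - t) * ((f (arefl a x) - f x) / (1 - exp (- aev (aff_cor a) x)))"
proof -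
  have "(t - inverse t) / d * y + (inverse t - t * e) / d * y' = t * y' + (inverse t - t) * ((y' - y) / d)"
    if "d = 1 - e" "d \<noteq> 0" for d e y y' :: complex
  proof -
    have "t * y' = (t * d * y') / d" using that by simp
    then have "t * y' + (inverse t - t) * ((y' - y) / d) = (t * d * y' + (inverse t - t) * (y' - y)) / d"
      by (simp add: add_divide_distrib)
    also have "t * d * y' + (inverse t - t) * (y' - y) = (t - inverse t) * y + (inverse t - t * e) * y'"
      unfolding that(1) by algebra
    finally show ?thesis by (simp add: add_divide_distrib)
  qed
  then show ?thesis using assms by (simp add: Tval_def Let_def)
qed

context based_root_system
begin

lemma Fcheck_periodic_simple:
  assumes "f \<in> Fcheck \<alpha>"
  shows "f (x + (2 * of_real pi * \<i> * of_int k) *s \<alpha> j) = f x"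
proof -
  have p: "f (x + (2 * of_real pi * \<i>) *s \<alpha> j) = f x" for x
    using assms by (simp add: Fcheck_def)
  have nat: "f (x + (2 * of_real pi * \<i> * of_nat n) *s \<alpha> j) = f x" for n x
  proof (induction n)
    case (Suc n)
    have "x + (2 * of_real pi * \<i> * of_nat (Suc n)) *s \<alpha> j
        = (x + (2 * of_real pi * \<i> * of_nat n) *s \<alpha> j) + (2 * of_real pi * \<i>) *s \<alpha> j"
      by (simp add: vec_eq_iff algebra_simps)
    then show ?case using Suc by (simp only: p)
  qed simp
  show ?thesis
  proof (cases k rule: int_cases2)
    case (nonneg n)
    then show ?thesis using nat by simp
  next
    case (nonpos n)
    have "x = (x + (2 * of_real pi * \<i> * of_int k) *s \<alpha> j) + (2 * of_real pi * \<i> * of_nat n) *s \<alpha> j"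
      using nonpos by (simp add: vec_eq_iff algebra_simps)
    then show ?thesis using nat by metis
  qed
qed

lemma Fcheck_periodic:
  assumes f: "f \<in> Fcheck \<alpha>" and a: "a \<in> R"
  shows "f (x + (2 * of_real pi * \<i> * of_int k) *s a) = f x"
proof -
  have "f (x + (\<Sum>j\<in>A. (2 * of_real pi * \<i> * of_int (m j)) *s \<alpha> j)) = f x" for A and m :: "'n \<Rightarrow> int"
  proof (induction A rule: infinite_finite_induct)
    case (insert j A)
    have "x + (\<Sum>j\<in>insert j A. (2 * of_real pi * \<i> * of_int (m j)) *s \<alpha> j)
      = (x + (\<Sum>j\<in>A. (2 * of_real pi * \<i> * of_int (m j)) *s \<alpha> j)) + (2 * of_real pi * \<i> * of_int (m j)) *s \<alpha> j"
      using insert by (simp add: add_ac)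
    then show ?case using insert.IH by (simp only: Fcheck_periodic_simple[OF f])
  qed auto
  moreover have "(2 * of_real pi * \<i> * of_int k) *s a = (\<Sum>j\<in>UNIV. (2 * of_real pi * \<i> * of_int (k * \<lfloor>co a j\<rfloor>)) *s \<alpha> j)"
  proof -
    have co: "complex_of_real (co a j) = of_int \<lfloor>co a j\<rfloor>" for j
      using co_Ints[OF a, of j] by (auto elim!: Ints_cases)
    have "(2 * of_real pi * \<i> * of_int k) *s a
        = (2 * of_real pi * \<i> * of_int k) *s (\<Sum>j\<in>UNIV. of_real (co a j) *s \<alpha> j)"
      using root_expand(1)[OF a] by (simp add: scaleR_eq_vector_scalar_mult)
    also have "\<dots> = (\<Sum>j\<in>UNIV. (2 * of_real pi * \<i> * of_int k * of_real (co a j)) *s \<alpha> j)"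
      by (simp add: vec_eq_iff sum_distrib_left mult.assoc)
    finally show ?thesis by (simp add: co mult.assoc)
  qed
  ultimately show ?thesis by (simp only:)
qed

lemma arefl_eq: "arefl (a, z) x = refl a x + (- (2 / bf a a * z)) *s a"
  by (simp add: arefl_def aev_def aff_cor_def refl_def cor_def bf_simps vector_scalar_mult_linear_left)

lemma holo_arefl: "holo f \<Longrightarrow> holo (\<lambda>x. f (arefl (a, z) x))"
  unfolding arefl_eq by (rule holo_compose_affine) (auto simp: refl_add refl_scale)

text \<open>At such points the reflection is a translation by an integer multiple of 2 pi i times
  \<open>a\<close>, which is a period of \<open>f\<close>.\<close>

lemma arefl_congruent:
  assumes f: "f \<in> Fcheck \<alpha>" and a: "a \<in> R" and e: "exp (- aev (aff_cor (a, z)) x) = 1"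
  shows "f (arefl (a, z) x) = f x"
proof -
  obtain k :: int where k: "aev (aff_cor (a, z)) x = 2 * of_real pi * \<i> * of_int k"
    using e by (auto simp: exp_minus_eq_1_iff)
  have "arefl (a, z) x = x + (2 * of_real pi * \<i> * of_int (- k)) *s a"
    by (simp add: arefl_def k vector_scalar_mult_linear_left)
  then show ?thesis by (simp only: Fcheck_periodic[OF f a])
qed

lemma aev_shift:
  assumes "a \<in> R"
  shows "exp (- aev (aff_cor (a, z)) (x + (2 * of_real pi * \<i>) *s \<alpha> j)) = exp (- aev (aff_cor (a, z)) x)"
proof -
  obtain k :: int where k: "bf (cor a) (\<alpha> j) = of_int k"
    using cor_int[OF assms simple_in[of j]] by (auto simp: bf_commute elim: Ints_cases)
  have "aev (aff_cor (a, z)) (x + y) = aev (aff_cor (a, z)) x + bf (cor a) y" for y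
    by (simp add: aev_def aff_cor_def cor_def bf_simps)
  then have "- aev (aff_cor (a, z)) (x + (2 * of_real pi * \<i>) *s \<alpha> j)
      = - aev (aff_cor (a, z)) x + - (2 * of_real pi * \<i> * of_int k)"
    by (simp add: bf_simps k)
  moreover have "exp (- (2 * of_real pi * \<i> * of_int k)) = (1::complex)"
    unfolding exp_minus_eq_1_iff by blast
  ultimately show ?thesis by (simp only: exp_add mult_1_right)
qed

lemma Tval_shift:
  assumes f: "f \<in> Fcheck \<alpha>" and a: "a \<in> R"
  shows "Tval t (a, z) f (x + (2 * of_real pi * \<i>) *s \<alpha> j) = Tval t (a, z) f x"
proof -
  let ?p = "(2 * of_real pi * \<i>) *s \<alpha> j"
  have "arefl (a, z) (x + ?p) = arefl (a, z) x + (2 * of_real pi * \<i> * of_int 1) *s refl a (\<alpha> j)"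
    by (simp add: arefl_eq refl_add refl_scale)
  then have "f (arefl (a, z) (x + ?p)) = f (arefl (a, z) x)"
    by (simp only: Fcheck_periodic[OF f refl_in[OF a simple_in]])
  moreover have "f (x + ?p) = f x" using f by (simp add: Fcheck_def)
  ultimately show ?thesis by (simp add: Tval_def aev_shift[OF a])
qed

text \<open>The divided difference extends by \<open>holo_division\<close>, in the direction a/2
  because the coroot takes the value 2 on \<open>a\<close>. Periodicity holds off the zeros since
  \<open>Tval\<close> is periodic there, and passes to the zeros by continuity.\<close>

lemma T_extends:
  assumes f: "f \<in> Fcheck \<alpha>" and a: "a \<in> R"
  shows "\<exists>g\<in>Fcheck \<alpha>. \<forall>x. exp (- aev (aff_cor (a, z)) x) \<noteq> 1 \<longrightarrow> g x = Tval t (a, z) f x"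
proof -
  have fh: "holo f" using f by (simp add: Fcheck_def)
  define c0 where "c0 = 2 / bf a a * z"
  have aev: "aev (aff_cor (a, z)) x = bf (cor a) x + c0" for x
    by (simp add: aev_def aff_cor_def cor_def c0_def)
  have ca: "bf (cor a) a = 2" using bf_root_nz[OF a] by (simp add: bf_cor)
  have "\<exists>q. holo q \<and> (\<forall>x. exp (- (bf (cor a) x + c0)) \<noteq> 1 \<longrightarrow>
          q x = (f (arefl (a, z) x) - f x) / (1 - exp (- (bf (cor a) x + c0))))"
  proof (rule holo_division)
    show "holo (\<lambda>x. f (arefl (a, z) x) - f x)"
      using holo_arefl[OF fh] fh holo_on_diff unfolding holo_iff by blast
    show "bf (cor a) ((1/2) *s a) = 1" by (simp add: bf_simps ca)
    show "f (arefl (a, z) x) - f x = 0" if "exp (- (bf (cor a) x + c0)) = 1" for x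
      using arefl_congruent[OF f a, of z x] that by (simp add: aev)
  qed
  then obtain q where q: "holo q" "\<And>x. exp (- (bf (cor a) x + c0)) \<noteq> 1 \<Longrightarrow>
          q x = (f (arefl (a, z) x) - f x) / (1 - exp (- (bf (cor a) x + c0)))" by blast
  define g where "g = (\<lambda>x. t * f (arefl (a, z) x) + (inverse t - t) * q x)"
  have gT: "g x = Tval t (a, z) f x" if "exp (- aev (aff_cor (a, z)) x) \<noteq> 1" for x
    using that q(2) Tval_eq[OF that] by (simp add: g_def aev)
  have gh: "holo g"
    using holo_arefl[OF fh, of a z] q(1) unfolding g_def holo_iff by (intro holo_on_add holo_on_cmult)
  have "g (x + (2 * of_real pi * \<i>) *s \<alpha> j) - g x = 0" for x j
  proof (rule vanish_by_continuity[where g = "\<lambda>x. g (x + (2 * of_real pi * \<i>) *s \<alpha> j) - g x" and c = "cor a" and v = a and d = c0])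
    show "isCont (\<lambda>x. g (x + (2 * of_real pi * \<i>) *s \<alpha> j) - g x) x"
      using holo_isCont[OF holo_shift[OF gh]] holo_isCont[OF gh] by (intro continuous_diff)
    show "bf (cor a) a \<noteq> 0" by (simp add: ca)
    fix \<zeta> assume *: "exp (- (bf (cor a) (x + \<zeta> *s a) + c0)) \<noteq> 1"
    let ?y = "x + \<zeta> *s a"
    have "exp (- aev (aff_cor (a, z)) ?y) \<noteq> 1" using * by (simp add: aev)
    moreover from this have "exp (- aev (aff_cor (a, z)) (?y + (2 * of_real pi * \<i>) *s \<alpha> j)) \<noteq> 1"
      by (simp only: aev_shift[OF a] not_False_eq_True)
    ultimately show "g (?y + (2 * of_real pi * \<i>) *s \<alpha> j) - g ?y = 0"
      using gT Tval_shift[OF f a] by simp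
  qed
  then have "g \<in> Fcheck \<alpha>" using gh by (simp add: Fcheck_def)
  then show ?thesis using gT by blast
qed

text \<open>The alternatives treat a whole piece of \<open>Dset\<close> at once: on it the
  coefficient of the reflected value is 0, or the reflected point is again in \<open>Dset\<close>.
  In the second case \<open>v\<close> is a direction within the piece along which the zeros of the
  denominator can be left.\<close>

lemma T_preserves_ideal:
  assumes f: "f \<in> ideal_D R \<alpha> J \<eta>" and a: "a \<in> R" and t: "t \<noteq> 0"
    and cases: "\<And>w. w \<in> Wplus R \<alpha> J \<Longrightarrow>
      (\<forall>x\<in>w ` D0 \<alpha> J \<eta>. t\<^sup>2 = exp (aev (aff_cor (a, z)) x)) \<or>
      (\<forall>x\<in>w ` D0 \<alpha> J \<eta>. arefl (a, z) x \<in> Dset R \<alpha> J \<eta>) \<and>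
      (\<exists>v. bf a v \<noteq> 0 \<and> (\<forall>x\<in>w ` D0 \<alpha> J \<eta>. \<forall>\<zeta>. x + \<zeta> *s v \<in> w ` D0 \<alpha> J \<eta>))"
  shows "\<exists>g\<in>ideal_D R \<alpha> J \<eta>. \<forall>x. exp (- aev (aff_cor (a, z)) x) \<noteq> 1 \<longrightarrow> g x = Tval t (a, z) f x"
proof -
  have fF: "f \<in> Fcheck \<alpha>" and f0: "\<And>x. x \<in> Dset R \<alpha> J \<eta> \<Longrightarrow> f x = 0"
    using f by (auto simp: ideal_D_def)
  obtain g where gF: "g \<in> Fcheck \<alpha>" and g: "\<And>x. exp (- aev (aff_cor (a, z)) x) \<noteq> 1 \<Longrightarrow> g x = Tval t (a, z) f x"
    using T_extends[OF fF a] by blast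
  have fh: "holo f" and gh: "holo g" using fF gF by (auto simp: Fcheck_def)
  define c0 where "c0 = 2 / bf a a * z"
  have aev: "aev (aff_cor (a, z)) x = bf (cor a) x + c0" for x
    by (simp add: aev_def aff_cor_def cor_def c0_def)
  have "g x = 0" if xD: "x \<in> Dset R \<alpha> J \<eta>" for x
  proof -
    obtain w where w: "w \<in> Wplus R \<alpha> J" "x \<in> w ` D0 \<alpha> J \<eta>" using xD by (auto simp: Dset_def)
    have wD: "y \<in> Dset R \<alpha> J \<eta>" if "y \<in> w ` D0 \<alpha> J \<eta>" for y using that w(1) by (auto simp: Dset_def)
    from cases[OF w(1)] show ?thesis
    proof (elim disjE conjE exE)
      assume "\<forall>x\<in>w ` D0 \<alpha> J \<eta>. t\<^sup>2 = exp (aev (aff_cor (a, z)) x)"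
      then have t2: "t\<^sup>2 = exp (aev (aff_cor (a, z)) x)" using w(2) by blast
      show ?thesis
      proof (cases "exp (- aev (aff_cor (a, z)) x) = 1")
        case False
        have "t * exp (- aev (aff_cor (a, z)) x) = t / t\<^sup>2" by (simp add: t2 exp_minus divide_inverse)
        also have "\<dots> = inverse t" using t by (simp add: power2_eq_square field_simps)
        finally show ?thesis using g[OF False] by (simp add: Tval_def Let_def f0[OF xD])
      next
        case True
        \<comment> \<open>With t its own inverse the divided difference drops out of
          \<open>Tval_eq\<close>; what remains is t times the reflected value, and the reflected
          point is congruent to x.\<close>
        then have "t * t = 1" using t2 by (simp add: exp_minus power2_eq_square)
        then have it: "inverse t = t" by (metis inverse_unique)
        have "g x - t * f (arefl (a, z) x) = 0"
        proof (rule vanish_by_continuity[where g = "\<lambda>x. g x - t * f (arefl (a, z) x)" and c = "cor a" and v = a and d = c0])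
          show "isCont (\<lambda>x. g x - t * f (arefl (a, z) x)) x"
            using holo_isCont[OF gh] holo_isCont[OF holo_arefl[OF fh]] by (intro continuous_intros)
          show "bf (cor a) a \<noteq> 0" using bf_root_nz[OF a] by (simp add: bf_cor)
          fix \<zeta> assume *: "exp (- (bf (cor a) (x + \<zeta> *s a) + c0)) \<noteq> 1"
          then have "exp (- aev (aff_cor (a, z)) (x + \<zeta> *s a)) \<noteq> 1" by (simp add: aev)
          from g[OF this] Tval_eq[OF this]
          show "g (x + \<zeta> *s a) - t * f (arefl (a, z) (x + \<zeta> *s a)) = 0" by (simp add: it)
        qed
        then show ?thesis using arefl_congruent[OF fF a True] f0[OF xD] by simp
      qed
    next
      fix v
      assume sD: "\<forall>x\<in>w ` D0 \<alpha> J \<eta>. arefl (a, z) x \<in> Dset R \<alpha> J \<eta>" and v: "bf a v \<noteq> 0"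
        and inv: "\<forall>x\<in>w ` D0 \<alpha> J \<eta>. \<forall>\<zeta>. x + \<zeta> *s v \<in> w ` D0 \<alpha> J \<eta>"
      show ?thesis
      proof (rule vanish_by_continuity[where c = "cor a" and v = v and d = c0])
        show "isCont g x" by (rule holo_isCont[OF gh])
        show "bf (cor a) v \<noteq> 0" using v bf_root_nz[OF a] by (simp add: bf_cor)
        fix \<zeta> assume *: "exp (- (bf (cor a) (x + \<zeta> *s v) + c0)) \<noteq> 1"
        have y: "x + \<zeta> *s v \<in> w ` D0 \<alpha> J \<eta>" using inv w(2) by blast
        have "exp (- aev (aff_cor (a, z)) (x + \<zeta> *s v)) \<noteq> 1" using * by (simp add: aev)
        from g[OF this] show "g (x + \<zeta> *s v) = 0"
          using f0[OF wD[OF y]] f0[of "arefl (a, z) (x + \<zeta> *s v)"] sD y by (simp add: Tval_def)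
      qed
    qed
  qed
  then have "g \<in> ideal_D R \<alpha> J \<eta>" using gF by (simp add: ideal_D_def)
  then show ?thesis using g by blast
qed

end

section \<open>Invariance of the ideal\<close>

context based_root_system
begin

lemma ideal_D_exp_mult:
  assumes f: "f \<in> ideal_D R \<alpha> J \<eta>" and \<mu>: "\<mu> \<in> coweights R"
  shows "(\<lambda>x. exp (bf \<mu> x + c) * f x) \<in> ideal_D R \<alpha> J \<eta>"
proof -
  have f': "holo f" "\<And>x j. f (x + (2 * pi * \<i>) *s \<alpha> j) = f x" "\<And>x. x \<in> Dset R \<alpha> J \<eta> \<Longrightarrow> f x = 0"
    using f by (auto simp: ideal_D_def Fcheck_def)
  have "holo (\<lambda>x. exp (bf \<mu> x + c) * f x)"
    using f'(1) unfolding holo_iff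
    by (intro holo_on_mult holo_on_exp holo_on_add holo_on_bf holo_on_const)
  moreover have "exp (bf \<mu> (x + (2 * pi * \<i>) *s \<alpha> j) + c) = exp (bf \<mu> x + c)" for x j
  proof -
    obtain k :: int where "bf (\<alpha> j) \<mu> = of_int k"
      using \<mu> simple_in[of j] by (auto simp: coweights_def elim: Ints_cases)
    then have "bf \<mu> (x + (2 * pi * \<i>) *s \<alpha> j) + c = (bf \<mu> x + c) + - (2 * of_real pi * \<i> * of_int (- k))"
      by (simp add: bf_simps bf_commute[of \<mu>])
    moreover have "exp (- (2 * of_real pi * \<i> * of_int (- k))) = (1::complex)"
      unfolding exp_minus_eq_1_iff by blast
    ultimately show ?thesis by (simp only: exp_add mult_1_right)
  qed
  ultimately show ?thesis using f'(2,3) by (simp add: ideal_D_def Fcheck_def)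
qed

text \<open>Meant for the inverse of pi_r, which satisfies the level condition at every positive
  root. A simple or affine reflection violates it at its own root and needs a case distinction for
  each piece of \<open>Dset\<close>.\<close>

lemma ideal_D_shift:
  assumes hc: "highest_cond h \<eta> J" and eta: "hatW_invariant R h \<eta>"
    and f: "f \<in> ideal_D R \<alpha> J \<eta>" and s: "s \<in> weyl R"
    and lev: "\<And>p. p \<in> Pos \<Longrightarrow> (bf p l = 0 \<and> s p \<in> Pos) \<or> (bf p l = 1 \<and> - s p \<in> Pos)"
  shows "(\<lambda>x. f (s (x - h *s l))) \<in> ideal_D R \<alpha> J \<eta>"
proof -
  have fF: "f \<in> Fcheck \<alpha>" and f0: "\<And>x. x \<in> Dset R \<alpha> J \<eta> \<Longrightarrow> f x = 0"
    using f by (auto simp: ideal_D_def)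
  have "holo (\<lambda>x. f (s x + (- s (h *s l))))"
    by (rule holo_compose_affine) (use fF s in \<open>auto simp: Fcheck_def weyl_add weyl_scale\<close>)
  then have "holo (\<lambda>x. f (s (x - h *s l)))" by (simp add: weyl_diff s)
  moreover have "f (s (x + (2 * pi * \<i>) *s \<alpha> j - h *s l)) = f (s (x - h *s l))" for x j
  proof -
    have "s (x + (2 * pi * \<i>) *s \<alpha> j - h *s l) = s (x - h *s l) + (2 * of_real pi * \<i> * of_int 1) *s s (\<alpha> j)"
      by (simp add: weyl_diff weyl_add weyl_scale s)
    then show ?thesis by (simp only: Fcheck_periodic[OF fF weyl_root[OF s simple_in]])
  qed
  moreover have "f (s (x - h *s l)) = 0" if xD: "x \<in> Dset R \<alpha> J \<eta>" for x
  proof -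
    obtain w y where w: "w \<in> Wplus R \<alpha> J" and y: "y \<in> D0 \<alpha> J \<eta>" and x: "x = w y"
      using xD by (auto simp: Dset_def)
    show ?thesis unfolding x
      by (intro f0 shift_into_Dset[OF hc eta w y s]) (rule lev[OF Wplus_pos[OF w]])
  qed
  ultimately show ?thesis by (simp add: ideal_D_def Fcheck_def)
qed

lemma Wplus_preimage_pos:
  assumes w: "w \<in> Wplus R \<alpha> J" and g: "g \<in> RJ J" and wg: "w g \<in> Pos"
  shows "g \<in> Pos"
proof (rule ccontr)
  assume "g \<notin> Pos"
  then have "- g \<in> Pos" using pos_or_neg RJ_in[OF g] by blast
  then have "w (- g) \<in> Pos" by (rule Wplus_pos[OF w neg_RJ[OF g]])
  then show False using wg not_pos_and_neg[OF wg] w by (simp add: weyl_minus Wplus_def)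
qed

text \<open>A root outside \<open>RJ J\<close> has a nonzero coordinate at some i not in
  \<open>J\<close>. The coweight \<open>b i\<close> pairs to 0 with the simple roots of
  \<open>J\<close>, so moving along it stays in \<open>D0\<close>.\<close>

lemma D0_free_direction:
  assumes w: "w \<in> weyl R" and g: "g \<in> R" "g \<notin> RJ J"
  shows "\<exists>v. bf (w g) v \<noteq> 0 \<and> (\<forall>x\<in>w ` D0 \<alpha> J \<eta>. \<forall>\<zeta>. x + \<zeta> *s v \<in> w ` D0 \<alpha> J \<eta>)"
proof -
  obtain i where i: "i \<notin> J" "co g i \<noteq> 0" using g by (auto simp: RJ_iff)
  have "bf (w g) (w (b i)) \<noteq> 0" using i by (simp add: weyl_bf w bf_b g)
  moreover have "w y + \<zeta> *s w (b i) \<in> w ` D0 \<alpha> J \<eta>" if "y \<in> D0 \<alpha> J \<eta>" for y \<zeta>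
  proof
    show "w y + \<zeta> *s w (b i) = w (y + \<zeta> *s b i)" by (simp add: weyl_add weyl_scale w)
    show "y + \<zeta> *s b i \<in> D0 \<alpha> J \<eta>"
      using that i(1) by (auto simp: D0_def bf_simps bf_cor dual)
  qed
  ultimately show ?thesis by blast
qed

text \<open>Pull \<open>\<alpha> k\<close> back by \<open>w\<close>. If the result lies in
  \<open>RJ J\<close>, it is simple by \<open>simple_image\<close>, and the coroot of
  \<open>\<alpha> k\<close> is constant on the piece, with value given by \<open>\<eta>\<close>. If
  not, the reflection keeps all image roots positive, with level 0.\<close>

lemma T_simple_preserves_ideal:
  assumes hc: "highest_cond h \<eta> J" and eta: "hatW_invariant R h \<eta>"
    and f: "f \<in> ideal_D R \<alpha> J \<eta>" and t: "t \<noteq> 0" "t\<^sup>2 = exp (\<eta> (aff_cor (\<alpha> k, 0)))"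
  shows "\<exists>g\<in>ideal_D R \<alpha> J \<eta>. \<forall>x. exp (- aev (aff_cor (\<alpha> k, 0)) x) \<noteq> 1 \<longrightarrow> g x = Tval t (\<alpha> k, 0) f x"
proof (rule T_preserves_ideal[OF f simple_in t(1)])
  fix w assume w: "w \<in> Wplus R \<alpha> J"
  then have wW: "w \<in> weyl R" by (simp add: Wplus_def)
  obtain w' where w': "w' \<in> weyl R" "\<And>x. w' (w x) = x" "\<And>x. w (w' x) = x" using weyl_inverse[OF wW] by blast
  define g where "g = w' (\<alpha> k)"
  have gR: "g \<in> R" and wg: "w g = \<alpha> k" unfolding g_def using weyl_root[OF w'(1) simple_in] w'(3) by auto
  show "(\<forall>x\<in>w ` D0 \<alpha> J \<eta>. t\<^sup>2 = exp (aev (aff_cor (\<alpha> k, 0)) x)) \<or>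
      (\<forall>x\<in>w ` D0 \<alpha> J \<eta>. arefl (\<alpha> k, 0) x \<in> Dset R \<alpha> J \<eta>) \<and>
      (\<exists>v. bf (\<alpha> k) v \<noteq> 0 \<and> (\<forall>x\<in>w ` D0 \<alpha> J \<eta>. \<forall>\<zeta>. x + \<zeta> *s v \<in> w ` D0 \<alpha> J \<eta>))"
  proof (cases "g \<in> RJ J")
    case True
    have gP: "g \<in> Pos" by (rule Wplus_preimage_pos[OF w True]) (simp add: wg simple_pos)
    have "\<exists>i. g = \<alpha> i"
    proof (rule simple_image[OF wW gP _ wg])
      fix i assume "co g i > 0"
      then have "i \<in> J" using RJ_co[OF True, of i] by force
      then show "w (\<alpha> i) \<in> Pos" using w by (simp add: Wplus_def)
    qed
    then obtain i where i: "g = \<alpha> i" by blast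
    then have iJ: "i \<in> J" using RJ_co[OF True, of i] by (auto simp: co_simple)
    have "aev (aff_cor (\<alpha> k, 0)) (w y) = \<eta> (aff_cor (\<alpha> k, 0))" if "y \<in> D0 \<alpha> J \<eta>" for y
    proof -
      have "aev (aff_cor (\<alpha> k, 0)) (w y) = bf (cor (w (\<alpha> i))) (w y)"
        using wg i by (simp add: aff_cor_0 aev_def)
      also have "\<dots> = \<eta> (aff_cor (\<alpha> i, 0))" using that iJ by (simp add: weyl_cor weyl_bf wW D0_def)
      also have "\<dots> = \<eta> (aff_cor (w (\<alpha> i), 0))" by (simp add: invariant_weyl[OF eta wW simple_in])
      finally show ?thesis using wg i by simp
    qed
    then show ?thesis using t(2) by auto
  next
    case False
    have "arefl (\<alpha> k, 0) (w y) \<in> Dset R \<alpha> J \<eta>" if y: "y \<in> D0 \<alpha> J \<eta>" for y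
    proof -
      have "refl (\<alpha> k) (w y - h *s 0) \<in> Dset R \<alpha> J \<eta>"
      proof (rule shift_into_Dset[OF hc eta w y refl_weyl[OF simple_in]])
        fix c assume c: "c \<in> RJ J" "c \<in> Pos"
        then have "w c \<noteq> \<alpha> k" using False w'(2) by (metis g_def)
        then show "bf (w c) 0 = 0 \<and> refl (\<alpha> k) (w c) \<in> Pos \<or> bf (w c) 0 = 1 \<and> - refl (\<alpha> k) (w c) \<in> Pos"
          using refl_simple_pos[OF Wplus_pos[OF w c]] by (simp add: bf_simps)
      qed
      then show ?thesis by (simp add: arefl_eq vector_scalar_mult_linear_right)
    qed
    then show ?thesis using D0_free_direction[OF wW gR False] unfolding wg by blast
  qed
qed

section \<open>The highest root and the affine node\<close>

context
  fixes \<theta> :: "complex^'n"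
  assumes th: "\<theta> \<in> R" and highest: "\<forall>c\<in>R. nncomb \<alpha> UNIV (\<theta> - c)"
begin

lemma highest_co: "c \<in> R \<Longrightarrow> co c i \<le> co \<theta> i"
  using nncomb_expand(3)[of UNIV "\<theta> - c" i] highest by (simp add: co_diff)

lemma highest_pos: "\<theta> \<in> Pos"
  unfolding pos_iff
proof (intro conjI th allI)
  show "co \<theta> i \<ge> 0" for i using highest_co[OF th, of i] highest_co[OF neg_in[OF th], of i] by (simp add: co_minus)
qed

lemma highest_unique: "c \<in> R \<Longrightarrow> (\<And>i. co \<theta> i \<le> co c i) \<Longrightarrow> c = \<theta>"
  by (rule co_eqI[OF _ th]) (auto intro: antisym highest_co)

text \<open>The Cartan integer k = (p, cor \<theta>) is not negative, as reflecting \<theta> in p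
  would then raise \<theta>. If k were at least 2, the root k \<theta> - p being below \<theta>
  would give p above \<theta>, hence p = \<theta>. For k = 1 the root \<theta> - p is
  positive.\<close>

lemma highest_level:
  assumes p: "p \<in> Pos" and ne: "p \<noteq> \<theta>"
  shows "(bf p (cor \<theta>) = 0 \<and> refl \<theta> p \<in> Pos) \<or> (bf p (cor \<theta>) = 1 \<and> - refl \<theta> p \<in> Pos)"
proof -
  have pR: "p \<in> R" by (rule pos_in[OF p])
  obtain k :: int where k: "bf p (cor \<theta>) = of_int k" using cor_int[OF th pR] by (auto elim: Ints_cases)
  have r: "refl \<theta> p = p - of_int k *\<^sub>R \<theta>"
    by (simp add: refl_def bf_commute[of _ p] k scaleR_eq_vector_scalar_mult)
  have rR: "refl \<theta> p \<in> R" by (rule refl_in[OF th pR])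
  have tt: "\<theta> \<bullet> \<theta> > 0" by (rule root_inner_pos[OF th])
  have "complex_of_real (2 * (p \<bullet> \<theta>) / (\<theta> \<bullet> \<theta>)) = complex_of_real (of_int k)"
    using k by (simp add: cor_def bf_simps bf_root pR th)
  then have kr: "2 * (p \<bullet> \<theta>) / (\<theta> \<bullet> \<theta>) = of_int k" unfolding of_real_eq_iff .
  have "k \<ge> 0"
  proof (rule ccontr)
    assume "\<not> k \<ge> 0"
    then have "2 * (p \<bullet> \<theta>) / (\<theta> \<bullet> \<theta>) < 0" using kr by simp
    then have neg: "p \<bullet> \<theta> < 0" using tt by (simp add: divide_less_0_iff)
    obtain i where "co p i \<noteq> 0" using ex_co_nonzero[OF pR] by blast
    then have i: "co p i > 0" using pos_co[OF p, of i] by linarith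
    have "co (refl p \<theta>) i = co \<theta> i - 2 * (p \<bullet> \<theta>) / (p \<bullet> p) * co p i"
      by (simp add: refl_eq_inner pR th co_diff co_scaleR)
    moreover have "2 * (p \<bullet> \<theta>) / (p \<bullet> p) < 0"
      using neg root_inner_pos[OF pR] by (intro divide_neg_pos) auto
    then have "2 * (p \<bullet> \<theta>) / (p \<bullet> p) * co p i < 0" using i by (rule mult_neg_pos)
    ultimately show False using highest_co[OF refl_in[OF pR th], of i] by simp
  qed
  moreover have "k \<le> 1"
  proof (rule ccontr)
    assume "\<not> k \<le> 1"
    then have k2: "real_of_int k \<ge> 2" by linarith
    have "co \<theta> i \<le> co p i" for i
    proof -
      have "of_int k * co \<theta> i - co p i \<le> co \<theta> i"
        using highest_co[OF neg_in[OF rR], of i] by (simp add: r co_simps)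
      moreover have "2 * co \<theta> i \<le> of_int k * co \<theta> i"
        using k2 pos_co[OF highest_pos] by (intro mult_right_mono) auto
      ultimately show ?thesis by linarith
    qed
    then show False using highest_unique[OF pR] ne by blast
  qed
  ultimately consider "k = 0" | "k = 1" by linarith
  then show ?thesis
  proof cases
    case 1
    then show ?thesis using k r p by simp
  next
    case 2
    have "co (- refl \<theta> p) i \<ge> 0" for i using highest_co[OF pR, of i] 2 by (simp add: r co_simps)
    then have "- refl \<theta> p \<in> Pos" using neg_in[OF rR] by (simp add: pos_iff)
    then show ?thesis using k 2 by simp
  qed
qed

text \<open>Brings s_0 into the form required by \<open>shift_into_Dset\<close>, with the coroot of
  \<theta> as the translation.\<close>

lemma arefl_affine_node: "arefl (- \<theta>, h) x = refl \<theta> (x - h *s cor \<theta>)"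
proof -
  have "refl \<theta> (x - h *s cor \<theta>) = refl \<theta> x + - (h * (2 / bf \<theta> \<theta>)) *s refl \<theta> \<theta>"
    using refl_add[of \<theta> x "- (h * (2 / bf \<theta> \<theta>)) *s \<theta>"]
    by (simp only: refl_scale) (simp add: cor_def vector_scalar_mult_linear_left)
  also have "\<dots> = refl \<theta> x + (h * (2 / bf \<theta> \<theta>)) *s \<theta>"
    by (simp add: refl_self bf_root_nz th vector_scalar_mult_linear_left vector_scalar_mult_linear_right)
  also have "refl \<theta> x = refl (- \<theta>) x"
    by (simp add: refl_def bf_cor bf_simps vector_scalar_mult_linear_left vector_scalar_mult_linear_right)
  finally show ?thesis
    by (simp add: arefl_eq bf_simps vector_scalar_mult_linear_left vector_scalar_mult_linear_right mult.commute)
qed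

text \<open>Pull \<theta> back by \<open>w\<close> to \<open>g\<close>. If \<open>g\<close> lies in
  \<open>RJ J\<close>, let \<theta>' be the highest root of its component. Then w (\<theta>' - g) is
  a nonnegative combination of positive roots, so w \<theta>' is above \<theta> and equals it; the
  value of h - \<theta> on the piece is then known from \<open>highest_root_value\<close>. If not,
  \<open>highest_level\<close> supplies the levels for the shift.\<close>

lemma T_affine_preserves_ideal:
  assumes hc: "highest_cond h \<eta> J" and eta: "hatW_invariant R h \<eta>"
    and f: "f \<in> ideal_D R \<alpha> J \<eta>" and t: "t \<noteq> 0" "t\<^sup>2 = exp (\<eta> (aff_cor (\<theta>, 0)))"
  shows "\<exists>g\<in>ideal_D R \<alpha> J \<eta>. \<forall>x. exp (- aev (aff_cor (- \<theta>, h)) x) \<noteq> 1 \<longrightarrow> g x = Tval t (- \<theta>, h) f x"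
proof (rule T_preserves_ideal[OF f neg_in[OF th] t(1)])
  fix w assume w: "w \<in> Wplus R \<alpha> J"
  then have wW: "w \<in> weyl R" by (simp add: Wplus_def)
  obtain w' where w': "w' \<in> weyl R" "\<And>x. w' (w x) = x" "\<And>x. w (w' x) = x" using weyl_inverse[OF wW] by blast
  define g where "g = w' \<theta>"
  have gR: "g \<in> R" and wg: "w g = \<theta>" unfolding g_def using weyl_root[OF w'(1) th] w'(3) by auto
  show "(\<forall>x\<in>w ` D0 \<alpha> J \<eta>. t\<^sup>2 = exp (aev (aff_cor (- \<theta>, h)) x)) \<or>
      (\<forall>x\<in>w ` D0 \<alpha> J \<eta>. arefl (- \<theta>, h) x \<in> Dset R \<alpha> J \<eta>) \<and>
      (\<exists>v. bf (- \<theta>) v \<noteq> 0 \<and> (\<forall>x\<in>w ` D0 \<alpha> J \<eta>. \<forall>\<zeta>. x + \<zeta> *s v \<in> w ` D0 \<alpha> J \<eta>))"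
  proof (cases "g \<in> RJ J")
    case True
    have "aev (aff_cor (- \<theta>, h)) (w y) = \<eta> (aff_cor (\<theta>, 0))" if y: "y \<in> D0 \<alpha> J \<eta>" for y
    proof -
      obtain \<theta>' where th': "\<theta>' \<in> RJ J" "\<And>i. co g i \<le> co \<theta>' i"
        "bf \<theta>' y = h - bf \<theta>' \<theta>' / 2 * \<eta> (aff_cor (\<theta>', 0))"
        using highest_root_value[OF hc True y] by blast
      have "w \<theta>' = \<theta>"
      proof (rule highest_unique)
        show "w \<theta>' \<in> R" by (rule weyl_root[OF wW RJ_in[OF th'(1)]])
        fix i
        have "(\<Sum>j\<in>J. (co \<theta>' j - co g j) *\<^sub>R \<alpha> j) = \<theta>' - g"
          unfolding scaleR_diff_left sum_subtractf RJ_expand[OF th'(1), symmetric] RJ_expand[OF True, symmetric] ..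
        then have "\<theta>' = g + (\<Sum>j\<in>J. (co \<theta>' j - co g j) *\<^sub>R \<alpha> j)" by simp
        from arg_cong[OF this, of w] have "w \<theta>' = \<theta> + (\<Sum>j\<in>J. (co \<theta>' j - co g j) *\<^sub>R w (\<alpha> j))"
          by (simp add: weyl_add weyl_sum weyl_scaleR wW wg)
        then have "co (w \<theta>') i = co \<theta> i + (\<Sum>j\<in>J. (co \<theta>' j - co g j) * co (w (\<alpha> j)) i)"
          by (simp add: co_add co_sum co_scaleR)
        moreover have "(\<Sum>j\<in>J. (co \<theta>' j - co g j) * co (w (\<alpha> j)) i) \<ge> 0"
          using th'(2) w by (intro sum_nonneg mult_nonneg_nonneg pos_co) (auto simp: Wplus_def)
        ultimately show "co \<theta> i \<le> co (w \<theta>') i" by simp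
      qed
      then have "bf \<theta> (w y) = bf \<theta>' y" "bf \<theta> \<theta> = bf \<theta>' \<theta>'" "\<eta> (aff_cor (\<theta>, 0)) = \<eta> (aff_cor (\<theta>', 0))"
        using weyl_bf[OF wW, of \<theta>'] invariant_weyl[OF eta wW RJ_in[OF th'(1)]] by auto
      with th'(3) have "bf \<theta> (w y) = h - bf \<theta> \<theta> / 2 * \<eta> (aff_cor (\<theta>, 0))" by simp
      then show ?thesis using bf_root_nz[OF th] by (simp add: aev_aff_cor bf_simps)
    qed
    then show ?thesis using t(2) by auto
  next
    case False
    have "arefl (- \<theta>, h) (w y) \<in> Dset R \<alpha> J \<eta>" if y: "y \<in> D0 \<alpha> J \<eta>" for y
      unfolding arefl_affine_node
    proof (rule shift_into_Dset[OF hc eta w y refl_weyl[OF th]])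
      fix c assume c: "c \<in> RJ J" "c \<in> Pos"
      then have "w c \<noteq> \<theta>" using False w'(2) by (metis g_def)
      then show "bf (w c) (cor \<theta>) = 0 \<and> refl \<theta> (w c) \<in> Pos \<or> bf (w c) (cor \<theta>) = 1 \<and> - refl \<theta> (w c) \<in> Pos"
        by (rule highest_level[OF Wplus_pos[OF w c]])
    qed
    then show ?thesis using D0_free_direction[OF wW gR False] unfolding wg by (auto simp: bf_simps)
  qed
qed

text \<open>As \<theta> has coefficient 1 at node r, a positive root has coefficient 0 or 1 there.
  If 0, only simple roots with simple images occur. If 1, look at the node s with u (-\<theta>) =
  \<open>\<alpha> s\<close>: no simple root other than \<open>\<alpha> r\<close> is sent to
  \<open>\<alpha> s\<close>, so the coordinate of u p at s is that of -\<theta>, which is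
  negative.\<close>

lemma diagram_automorphism_level:
  assumes r: "co \<theta> r = 1" and u: "u \<in> weyl R"
    and perm: "u ` insert (- \<theta>) (range \<alpha>) = insert (- \<theta>) (range \<alpha>)" and ur: "u (\<alpha> r) = - \<theta>"
    and p: "p \<in> Pos"
  shows "(bf p (b r) = 0 \<and> u p \<in> Pos) \<or> (bf p (b r) = 1 \<and> - u p \<in> Pos)"
proof -
  have pR: "p \<in> R" and upR: "u p \<in> R" using pos_in[OF p] weyl_root[OF u] by auto
  obtain u' where u': "\<And>x. u' (u x) = x" using weyl_inverse[OF u] by blast
  have inj: "u x = u y \<Longrightarrow> x = y" for x y using u' by metis
  have nsim: "- \<theta> \<noteq> \<alpha> i" for i using not_pos_and_neg[OF highest_pos] simple_pos[of i] by metis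
  have asim: "\<alpha> i \<noteq> \<alpha> j" if "i \<noteq> j" for i j using co_simple[of i i] co_simple[of j i] that by auto
  have img: "u x \<in> range \<alpha>" if "x \<in> insert (- \<theta>) (range \<alpha>)" "x \<noteq> \<alpha> r" for x
    using perm that ur inj[of x "\<alpha> r"] by (metis image_eqI insert_iff)
  obtain s where s: "u (- \<theta>) = \<alpha> s" using img[of "- \<theta>"] nsim by auto
  have other: "\<exists>k. k \<noteq> s \<and> u (\<alpha> i) = \<alpha> k" if ir: "i \<noteq> r" for i
  proof -
    obtain k where k: "u (\<alpha> i) = \<alpha> k" using img[of "\<alpha> i"] asim[OF ir] by auto
    moreover have "k \<noteq> s" using k s inj[of "\<alpha> i" "- \<theta>"] nsim[of i] by metis
    ultimately show ?thesis by blast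
  qed
  have up: "co (u p) j = (\<Sum>i\<in>UNIV. co p i * co (u (\<alpha> i)) j)" for j
    using arg_cong[OF root_expand(1)[OF pR], of u] by (simp add: weyl_sum weyl_scaleR u co_sum co_scaleR)
  obtain k :: int where k: "co p r = of_int k" using co_Ints[OF pR, of r] by (auto elim: Ints_cases)
  moreover have "0 \<le> co p r" "co p r \<le> 1" using pos_co[OF p] highest_co[OF pR, of r] r by auto
  ultimately consider "co p r = 0" | "co p r = 1" by force
  then show ?thesis
  proof cases
    case 1
    have "co p i * co (u (\<alpha> i)) j \<ge> 0" for i j
    proof (cases "i = r")
      case False
      then obtain k where "u (\<alpha> i) = \<alpha> k" using other by blast
      then show ?thesis using pos_co[OF p] by (simp add: co_simple)
    qed (simp add: 1)
    then have "co (u p) j \<ge> 0" for j unfolding up by (intro sum_nonneg)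
    then have "u p \<in> Pos" using upR by (simp add: pos_iff)
    then show ?thesis using 1 by (simp add: bf_b pR)
  next
    case 2
    have "co p i * co (u (\<alpha> i)) s = 0" if "i \<noteq> r" for i
      using other[OF that] by (auto simp: co_simple)
    then have "co (u p) s = (\<Sum>i\<in>{r}. co p i * co (u (\<alpha> i)) s)"
      unfolding up by (intro sum.mono_neutral_right) auto
    also have "\<dots> = - co \<theta> s" by (simp add: 2 ur co_minus)
    also have "\<dots> < 0" using highest_co[OF simple_in[of s], of s] by (simp add: co_simple)
    finally have "u p \<notin> Pos" using pos_co[of "u p" s] by linarith
    then have "- u p \<in> Pos" using pos_or_neg[OF upR] by blast
    then show ?thesis using 2 by (simp add: bf_b pR)
  qed
qed

end

end

theorem mainTheorem20:
  fixes R :: "(complex^'n) set" and \<alpha> :: "'n \<Rightarrow> complex^'n"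
    and \<theta> :: "complex^'n" and nn :: "'n \<Rightarrow> nat" and b :: "'n \<Rightarrow> complex^'n"
    and h :: complex and t \<eta> :: "(complex^'n) \<times> complex \<Rightarrow> complex"
    and J :: "'n set" and ep :: int
  assumes rs: "is_root_system R" and irr: "irreducible_rs R"
    and simple: "simple_system R \<alpha>"
    and theta: "\<theta> \<in> R" "\<forall>c\<in>R. nncomb \<alpha> UNIV (\<theta> - c)"
    and nn: "\<theta> = (\<Sum>i\<in>UNIV. of_nat (nn i) *s \<alpha> i)"
    and b: "\<forall>i j. bf (\<alpha> j) (b i) = (if i = j then 1 else 0)"
    and hbar: "h \<noteq> 0" "\<forall>q\<in>\<rat>. h \<noteq> complex_of_real pi * \<i> * of_real q"
    and tinv: "hatW_invariant R h t" and etainv: "hatW_invariant R h \<eta>"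
    and tnz: "\<forall>a\<in>aff_coroots R h. t a \<noteq> 0"
    and ep: "ep > 0" "\<forall>l\<in>coweights R. \<forall>l'\<in>coweights R. of_int ep * bf l l' \<in> \<int>"
    and hcond: "\<forall>C thC m. is_component (R0 R \<alpha> J) C \<and> thC \<in> C
                  \<and> (\<forall>c\<in>C. nncomb \<alpha> {j\<in>J. \<alpha> j \<in> C} (thC - c))
                  \<and> thC = (\<Sum>j\<in>{j\<in>J. \<alpha> j \<in> C}. of_nat (m j) *s \<alpha> j)
                  \<longrightarrow> hcheck \<alpha> {j\<in>J. \<alpha> j \<in> C} \<eta> thC m = h"
    and tcond: "\<forall>a\<in>R. (t (aff_cor (a, 0)))\<^sup>2 = exp (\<eta> (aff_cor (a, 0)))"
  shows "(\<forall>f\<in>ideal_D R \<alpha> J \<eta>. \<forall>\<mu>\<in>coweights R. \<forall>k::int.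
            (\<lambda>x. exp (bf \<mu> x + h / of_int ep * of_int k) * f x) \<in> ideal_D R \<alpha> J \<eta>)
       \<and> (\<forall>f\<in>ideal_D R \<alpha> J \<eta>. \<forall>i. nn i = 1 \<longrightarrow>
            (\<forall>u\<in>weyl R. u ` insert (- \<theta>) (range \<alpha>) = insert (- \<theta>) (range \<alpha>) \<and> u (\<alpha> i) = - \<theta>
               \<longrightarrow> (\<lambda>x. f (u (x - h *s b i))) \<in> ideal_D R \<alpha> J \<eta>))
       \<and> (\<forall>f\<in>ideal_D R \<alpha> J \<eta>. \<forall>i::'n option. \<exists>g\<in>ideal_D R \<alpha> J \<eta>.
            \<forall>x. exp (- aev (aff_cor (anode \<alpha> \<theta> h i)) x) \<noteq> 1 \<longrightarrow>
               g x = Tval (t (aff_cor (anode \<alpha> \<theta> h i))) (anode \<alpha> \<theta> h i) f x)"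
proof -
  interpret based_root_system R \<alpha> b
    by standard (use rs simple b in auto)
  have hc: "highest_cond h \<eta> J" unfolding highest_cond_def by (rule hcond)
  have pos: "\<theta> \<in> pos_roots R \<alpha>" by (rule highest_pos[OF theta])
  have T: "\<exists>g\<in>ideal_D R \<alpha> J \<eta>. \<forall>x. exp (- aev (aff_cor (anode \<alpha> \<theta> h i)) x) \<noteq> 1 \<longrightarrow>
       g x = Tval (t (aff_cor (anode \<alpha> \<theta> h i))) (anode \<alpha> \<theta> h i) f x"
    if f: "f \<in> ideal_D R \<alpha> J \<eta>" for f i
  proof (cases i)
    case None
    \<comment> \<open>The relation between t and \<open>\<eta>\<close> is assumed for coroots of
      \<open>R\<close>; invariance of t carries it to the coroot of node 0.\<close>
    have t: "t (aff_cor (- \<theta>, h)) = t (aff_cor (\<theta>, 0))" by (rule invariant_affine_node[OF tinv pos])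
    have "t (aff_cor (\<theta>, 0)) \<noteq> 0" using tnz aff_coroots_0[OF theta(1)] by blast
    then show ?thesis
      using T_affine_preserves_ideal[OF theta hc etainv f] tcond theta(1) None by (simp add: anode_def t)
  next
    case (Some k)
    have "t (aff_cor (\<alpha> k, 0)) \<noteq> 0" using tnz aff_coroots_0[OF simple_in] by blast
    then show ?thesis
      using T_simple_preserves_ideal[OF hc etainv f] tcond simple_in Some by (simp add: anode_def)
  qed
  have P: "(\<lambda>x. f (u (x - h *s b i))) \<in> ideal_D R \<alpha> J \<eta>"
    if f: "f \<in> ideal_D R \<alpha> J \<eta>" and i: "nn i = 1" and u: "u \<in> weyl R"
      "u ` insert (- \<theta>) (range \<alpha>) = insert (- \<theta>) (range \<alpha>)" "u (\<alpha> i) = - \<theta>" for f i u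
  proof (rule ideal_D_shift[OF hc etainv f u(1)])
    have "co \<theta> i = (\<Sum>j\<in>UNIV. real (nn j) * co (\<alpha> j) i)"
      by (subst nn) (simp only: of_nat_scale co_sum co_scaleR)
    then have "co \<theta> i = 1" using i by (simp add: co_simple if_distrib cong: if_cong)
    then show "(bf p (b i) = 0 \<and> u p \<in> pos_roots R \<alpha>) \<or> (bf p (b i) = 1 \<and> - u p \<in> pos_roots R \<alpha>)"
      if "p \<in> pos_roots R \<alpha>" for p
      using diagram_automorphism_level[OF theta _ u that] by blast
  qed
  show ?thesis using T P ideal_D_exp_mult by blast
qed

end
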